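(* Let $n\geq 4$, let $K$ be the complete graph with vertex set $[n]=\{1,\ldots,n\}$, and let $c:E(K)\to\{\pm 1\}$ be an edge labeling of $K$ such that the number of edges $e$ with $c(e)=+1$ equals $d{n\choose 2}$ (for some real number $d$). Let $\Delta$ be a positive integer and let $G$ be a spanning subgraph of $K$ of maximum degree at most $\Delta$. Then there is a permutation $\pi\in S_n$ with $$m^+(G_\pi)\geq \begin{cases} \left(d+\frac{2-d-2\sqrt{1-d}}{2\Delta+1}-\frac{3}{n-3}\right)m(G), & \mbox{if } d{n\choose 2}\leq \frac{8n^2-14n+3}{25},\\[3mm] \left(d+\frac{\sqrt{d}-d}{2\Delta+1}-\frac{3}{n-3}\right)m(G), & \mbox{otherwise}. \end{cases}$$
   Context: Edges with label $+1$ are called plus-edges. For a subgraph $H$ of $K$, $m(H)$ denotes the number of edges of $H$ and $m^+(H)$ the number of plus-edges of $H$. For a permutation $\pi\in S_n$ (the symmetric group on $[n]$), $G_\pi$ denotes the isomorphic copy of $G$ in $K$ with vertex set $[n]$ and edge set $\{\pi(u)\pi(v): uv\in E(G)\}$. *)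

theory Defs
  imports Complex_Main "HOL-Library.FuncSet" "HOL-Combinatorics.Permutations"
begin

text \<open>Simple undirected graphs on natural numbers: a vertex set together with a set of edges,
  where the edge \<open>uv\<close> is the two-element set \<open>{u, v}\<close>.\<close>

type_synonym graph = "nat set \<times> nat set set"

definition verts :: "graph \<Rightarrow> nat set" where
  "verts H = fst H"

definition edges :: "graph \<Rightarrow> nat set set" where
  "edges H = snd H"

definition complete_graph :: "nat \<Rightarrow> graph" where
  "complete_graph n = ({1..n}, {{u, v} | u v. u \<in> {1..n} \<and> v \<in> {1..n} \<and> u \<noteq> v})"

definition subgraph :: "graph \<Rightarrow> graph \<Rightarrow> bool" where
  "subgraph H G \<longleftrightarrow> verts H \<subseteq> verts G \<and> edges H \<subseteq> edges G \<and> (\<forall>e\<in>edges H. e \<subseteq> verts H)"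

definition spanning_subgraph :: "graph \<Rightarrow> graph \<Rightarrow> bool" where
  "spanning_subgraph H G \<longleftrightarrow> subgraph H G \<and> verts H = verts G"

definition degree :: "graph \<Rightarrow> nat \<Rightarrow> nat" where
  "degree H v = card {e \<in> edges H. v \<in> e}"

text \<open>Only meaningful for graphs with a finite nonempty vertex set.\<close>

definition max_degree :: "graph \<Rightarrow> nat" where
  "max_degree H = Max (degree H ` verts H)"

definition num_edges :: "graph \<Rightarrow> nat" where
  "num_edges H = card (edges H)"

definition num_plus_edges :: "(nat set \<Rightarrow> int) \<Rightarrow> graph \<Rightarrow> nat" where
  "num_plus_edges c H = card {e \<in> edges H. c e = 1}"

text \<open>The copy \<open>G\<^sub>\<pi>\<close>: the image \<open>\<pi> ` {u, v}\<close> is the edge \<open>\<pi>(u)\<pi>(v)\<close>, and the vertex set is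
  unchanged when \<open>\<pi>\<close> permutes it.\<close>

definition permuted_copy :: "(nat \<Rightarrow> nat) \<Rightarrow> graph \<Rightarrow> graph" where
  "permuted_copy \<pi> G = (\<pi> ` verts G, (\<lambda>e. \<pi> ` e) ` edges G)"

end

theory Submission
  imports Defs
begin

text \<open>
  Let \<open>k\<close> be the matching number of the graph of plus-edges and \<open>t = n div 2\<close>. Choose a perfect
  matching \<open>Q\<close> of (almost) all vertices with \<open>k\<close> plus-edges, and a perfect matching \<open>P\<close> that
  extends a maximum matching of \<open>G\<close>; the latter has at least \<open>m(G) / (2 * \<Delta>)\<close> edges. If \<open>G\<close> is
  placed at random subject to \<open>P\<close> being mapped onto \<open>Q\<close>, then the edges of \<open>G\<close> in \<open>P\<close> become plus-edges
  with probability \<open>k / t\<close> and the other edges with probability about \<open>d\<close>. The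
  Erdos--Gallai theorem bounds \<open>2 * k / n\<close> from below by about \<open>2 - 2 * sqrt (1 - d)\<close> or \<open>sqrt d\<close>.
  For odd \<open>n\<close>, a vertex of minimum degree of \<open>G\<close> is matched to a vertex of the complete graph
  that a maximum matching of plus-edges misses, and all edges at these two vertices are given up.
\<close>

subsection \<open>Matchings\<close>

text \<open>Encoded as a family of disjoint pairs without reference to a graph, since the perfect
  matchings \<open>P\<close> and \<open>Q\<close> used later may contain arbitrary pairs of
  vertices.\<close>

definition matching :: "'a set set \<Rightarrow> bool" where
  "matching M \<longleftrightarrow> (\<forall>e\<in>M. card e = 2) \<and> pairwise disjnt M"

lemma matching_empty [simp]: "matching {}"
  by (simp add: matching_def)

lemma matching_subset: "matching M \<Longrightarrow> N \<subseteq> M \<Longrightarrow> matching N"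
  unfolding matching_def by (auto intro: pairwise_subset)

lemma matching_insert:
  "matching M \<Longrightarrow> card e = 2 \<Longrightarrow> e \<inter> \<Union>M = {} \<Longrightarrow> matching (insert e M)"
  unfolding matching_def pairwise_insert disjnt_def by blast

lemma matching_eqI: "matching M \<Longrightarrow> e \<in> M \<Longrightarrow> f \<in> M \<Longrightarrow> x \<in> e \<Longrightarrow> x \<in> f \<Longrightarrow> e = f"
  unfolding matching_def pairwise_def disjnt_def by blast

lemma matching_Union_remove:
  assumes "matching M" "e \<in> M"
  shows "\<Union>(M - {e}) = \<Union>M - e"
  using matching_eqI[OF assms(1) _ assms(2)] by auto

lemma matching_card_Union: "matching M \<Longrightarrow> finite M \<Longrightarrow> card (\<Union>M) = 2 * card M"
  unfolding matching_def
  by (subst card_Union_disjoint) (auto simp: card_ge_0_finite)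

lemma matching_edge_cases:
  assumes "matching M" "x \<in> \<Union>M"
  obtains y where "{x, y} \<in> M" "y \<noteq> x"
proof -
  obtain e where e: "e \<in> M" "x \<in> e" using assms(2) by blast
  then have "card e = 2" using assms(1) by (simp add: matching_def)
  then obtain u v where uv: "e = {u, v}" "u \<noteq> v" by (auto simp: card_2_iff)
  show thesis
  proof (cases "x = u")
    case True then show thesis using that[of v] e uv by auto
  next
    case False then show thesis using that[of u] e uv by (auto simp: insert_commute)
  qed
qed

text \<open>This replaces the usual argument with alternating paths in the symmetric difference
  of \<open>M\<close> and \<open>N\<close>: the induction removes the first two edges of the path that starts in \<open>b\<close>.\<close>

lemma matching_exchange:
  assumes "finite M" "matching M" "finite N" "matching N" "a \<noteq> c"
    "a \<notin> \<Union>M" "c \<notin> \<Union>M" "b \<notin> \<Union>N"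
  shows "(\<exists>L\<subseteq>M \<union> N. matching L \<and> card L = Suc (card N)) \<or>
    (\<exists>L\<subseteq>M \<union> N. matching L \<and> card L = card M \<and> b \<notin> \<Union>L \<and> (\<exists>x\<in>{a, c}. x \<noteq> b \<and> x \<notin> \<Union>L))"
  using assms
proof (induction "card M" arbitrary: M N b rule: less_induct)
  case less
  show ?case
  proof (cases "b \<in> \<Union>M")
    case False
    \<comment> \<open>Here \<open>L = M\<close> works; since \<open>a \<noteq> c\<close>, one of the
      two differs from \<open>b\<close>.\<close>
    then show ?thesis using less.prems by (metis Un_upper1 insertCI)
  next
    case True
    then obtain b1 where b1: "{b, b1} \<in> M" "b1 \<noteq> b"
      using matching_edge_cases less.prems(2) by metis
    have cb1: "card {b, b1} = 2" using b1 by simp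
    show ?thesis
    proof (cases "b1 \<in> \<Union>N")
      case False
      then have "matching (insert {b, b1} N)"
        using matching_insert[OF less.prems(4) cb1] less.prems(8) by blast
      moreover have "{b, b1} \<notin> N" using less.prems(8) by blast
      ultimately show ?thesis using b1 less.prems(3)
        by (metis UnCI card_insert_disjoint insert_subset sup_ge2)
    next
      case b1N: True
      obtain b2 where b2: "{b1, b2} \<in> N" "b2 \<noteq> b1"
        using matching_edge_cases less.prems(4) b1N by metis
      have b2b: "b2 \<noteq> b" using b2 less.prems(8) by blast
      define M' where "M' = M - {{b, b1}}"
      define N' where "N' = N - {{b1, b2}}"
      have U: "\<Union>M' = \<Union>M - {b, b1}" "\<Union>N' = \<Union>N - {b1, b2}"
        unfolding M'_def N'_def using matching_Union_remove[OF less.prems(2) b1(1)]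
          matching_Union_remove[OF less.prems(4) b2(1)] by simp_all
      have cM: "card M = Suc (card M')" and cN: "card N = Suc (card N')"
        unfolding M'_def N'_def
        using card.remove[OF less.prems(1) b1(1)] card.remove[OF less.prems(3) b2(1)] by simp_all
      have f: "finite M'" "finite N'" "matching M'" "matching N'"
        using less.prems(1-4) matching_subset[of M M'] matching_subset[of N N']
        by (auto simp: M'_def N'_def)
      have sub: "M' \<subseteq> M" "N' \<subseteq> N" by (auto simp: M'_def N'_def)
      \<comment> \<open>\<open>M'\<close> and \<open>N'\<close> both leave \<open>b\<close> and
        \<open>b1\<close> uncovered, so a matching found by the induction hypothesis, with
        \<open>b2\<close> as the new start, can be extended by one of the removed edges.\<close>
      have miss: "b \<notin> \<Union>L" "b1 \<notin> \<Union>L" if "L \<subseteq> M' \<union> N'" for L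
      proof -
        have "\<Union>L \<subseteq> \<Union>M' \<union> \<Union>N'" using that by blast
        then show "b \<notin> \<Union>L" "b1 \<notin> \<Union>L" using U less.prems(8) by (simp_all only: subset_iff) blast+
      qed
      have new: "matching (insert e L)" "card (insert e L) = Suc (card L)"
        if "L \<subseteq> M' \<union> N'" "matching L" "e \<inter> \<Union>L = {}" "card e = 2" for e L
      proof -
        have "finite L" using that(1) f by (meson finite_UnI finite_subset)
        moreover have "e \<notin> L" using that(3,4) by (metis Int_absorb2 Sup_upper card.empty zero_neq_numeral)
        ultimately show "card (insert e L) = Suc (card L)" by simp
        show "matching (insert e L)" using matching_insert that by blast
      qed
      consider L where "L \<subseteq> M' \<union> N'" "matching L" "card L = Suc (card N')"
        | L x where "L \<subseteq> M' \<union> N'" "matching L" "card L = card M'" "b2 \<notin> \<Union>L"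
            "x \<in> {a, c}" "x \<noteq> b2" "x \<notin> \<Union>L"
        using less.hyps[of M' N' b2] cM f less.prems(5-8) U by auto
      \<comment> \<open>A matching larger than \<open>N'\<close> is extended by the
        \<open>M\<close>-edge \<open>{b, b1}\<close>. One that has the size of \<open>M'\<close> and
        misses \<open>b2\<close> is extended by the \<open>N\<close>-edge \<open>{b1, b2}\<close>,
        which leaves \<open>b\<close> uncovered.\<close>
      then show ?thesis
      proof cases
        case 1
        note n = new[of L "{b, b1}", OF 1(1,2)] 
        have "{b, b1} \<inter> \<Union>L = {}" using miss 1 by auto
        then have "matching (insert {b, b1} L)" "card (insert {b, b1} L) = Suc (card N)"
          using n cb1 1 cN by auto
        moreover have "insert {b, b1} L \<subseteq> M \<union> N" using 1 b1 sub by auto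
        ultimately show ?thesis by metis
      next
        case 2
        have c2: "card {b1, b2} = 2" using b2 by simp
        have d: "{b1, b2} \<inter> \<Union>L = {}" using miss 2 by auto
        have "matching (insert {b1, b2} L)" "card (insert {b1, b2} L) = card M"
          using new[OF 2(1,2) d c2] 2 cM by auto
        moreover have "insert {b1, b2} L \<subseteq> M \<union> N" using 2 b2 sub by auto
        moreover have "b \<notin> \<Union>(insert {b1, b2} L)" using miss(1)[OF 2(1)] b1 b2b by auto
        moreover have "x \<noteq> b" "x \<notin> \<Union>(insert {b1, b2} L)"
          using 2 True b1 less.prems(6,7) by auto
        ultimately show ?thesis using 2(5) by metis
      qed
    qed
  qed
qed

section \<open>Maximum matchings and the Erdos--Gallai bound\<close>

definition matching_number :: "'a set set \<Rightarrow> nat" where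
  "matching_number E = Max (card ` {M. M \<subseteq> E \<and> matching M})"

lemma card_matching_le: "finite E \<Longrightarrow> M \<subseteq> E \<Longrightarrow> matching M \<Longrightarrow> card M \<le> matching_number E"
  unfolding matching_number_def by (rule Max_ge) auto

lemma maximum_matching:
  assumes "finite E"
  obtains M where "M \<subseteq> E" "matching M" "card M = matching_number E"
proof -
  have "matching_number E \<in> card ` {M. M \<subseteq> E \<and> matching M}"
    unfolding matching_number_def using assms by (intro Max_in) auto
  then show thesis using that by auto
qed

lemma matching_number_mono:
  assumes "finite E" "F \<subseteq> E" shows "matching_number F \<le> matching_number E"
proof -
  obtain M where "M \<subseteq> F" "matching M" "card M = matching_number F"
    using maximum_matching finite_subset assms by metis
  then show ?thesis using card_matching_le[of E M] assms by auto
qed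

lemma maximum_matching_meets:
  assumes "finite E" "M \<subseteq> E" "matching M" "card M = matching_number E" "e \<in> E" "card e = 2"
  shows "e \<inter> \<Union>M \<noteq> {}"
proof
  assume d: "e \<inter> \<Union>M = {}"
  then have "e \<notin> M" using assms(6) by (metis Int_absorb2 Sup_upper card.empty zero_neq_numeral)
  then have "card (insert e M) = Suc (card M)" using assms finite_subset by (metis card_insert_disjoint)
  moreover have "card (insert e M) \<le> matching_number E"
    using assms matching_insert d by (intro card_matching_le) auto
  ultimately show False using assms(4) by simp
qed

text \<open>A numerical form of Gallai's lemma: for a maximum matching \<open>M\<close>, every vertex in \<open>\<Union>M\<close> has
  degree at most \<open>2 * card M\<close>, and by the exchange property at most one neighbour outside of \<open>\<Union>M\<close>.\<close>

lemma card_le_if_all_vertices_missed: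
  assumes E: "finite E" "\<And>e. e \<in> E \<Longrightarrow> card e = 2"
    and missed: "\<And>v. v \<in> \<Union>E \<Longrightarrow> \<exists>M\<subseteq>E. matching M \<and> card M = matching_number E \<and> v \<notin> \<Union>M"
  shows "2 * card E \<le> 2 * matching_number E * (2 * matching_number E + 1)"
proof -
  define k where "k = matching_number E"
  obtain M where M: "M \<subseteq> E" "matching M" "card M = k"
    using maximum_matching E(1) k_def by metis
  have fM: "finite M" using M E finite_subset by blast
  have cU: "card (\<Union>M) = 2 * k" using matching_card_Union M fM by blast
  have finE: "finite e" if "e \<in> E" for e using E(2)[OF that] by (simp add: card_ge_0_finite)
  have fU: "finite (\<Union>M)" using fM finE M by blast
  \<comment> \<open>Every edge at \<open>v\<close> meets a maximum matching \<open>L\<close> that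
    misses \<open>v\<close>, so its other end is one of the \<open>2 * k\<close> vertices of
    \<open>L\<close>.\<close>
  have deg: "card {e\<in>E. v \<in> e} \<le> 2 * k" if v: "v \<in> \<Union>M" for v
  proof -
    have "v \<in> \<Union>E" using v M by blast
    then obtain L where L: "L \<subseteq> E" "matching L" "card L = k" "v \<notin> \<Union>L"
      using missed k_def by metis
    have fL: "finite L" using L E finite_subset by blast
    have "{e\<in>E. v \<in> e} \<subseteq> (\<lambda>u. {v, u}) ` \<Union>L"
    proof
      fix e assume "e \<in> {e\<in>E. v \<in> e}"
      then have e: "e \<in> E" "v \<in> e" by auto
      then obtain u where u: "e = {v, u}" using E(2)[OF e(1)] by (auto simp: card_2_iff)
      have "e \<inter> \<Union>L \<noteq> {}" using maximum_matching_meets[of E L e] E L e k_def by simp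
      then show "e \<in> (\<lambda>u. {v, u}) ` \<Union>L" using u L(4) by auto
    qed
    moreover have "finite (\<Union>L)" using fL finE L by blast
    ultimately have "card {e\<in>E. v \<in> e} \<le> card (\<Union>L)" by (rule surj_card_le[rotated])
    then show ?thesis using matching_card_Union L fL by metis
  qed
  define A where "A = {e\<in>E. e \<subseteq> \<Union>M}"
  define B where "B = {e\<in>E. \<not> e \<subseteq> \<Union>M}"
  have AB: "E = A \<union> B" "A \<inter> B = {}" "finite A" "finite B" using E by (auto simp: A_def B_def)
  have B1: "\<exists>u v. e = {u, v} \<and> u \<in> \<Union>M \<and> v \<notin> \<Union>M" if "e \<in> B" for e
  proof -
    have e: "e \<in> E" "\<not> e \<subseteq> \<Union>M" using that by (auto simp: B_def)
    then obtain v where v: "v \<in> e" "v \<notin> \<Union>M" by blast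
    then obtain u where u: "e = {v, u}" using E(2)[OF e(1)] by (auto simp: card_2_iff)
    have "e \<inter> \<Union>M \<noteq> {}" using maximum_matching_meets[of E M e] E M e k_def by simp
    then show ?thesis using u v by (intro exI[of _ u] exI[of _ v]) auto
  qed
  \<comment> \<open>Two outer neighbours \<open>v\<close>, \<open>v'\<close> of \<open>u\<close>
    contradict maximality: the exchange with a maximum matching that misses \<open>u\<close> gives a
    larger matching, or one of size \<open>k\<close> that misses \<open>u\<close> and one of
    \<open>v\<close>, \<open>v'\<close>, and then the edge between these two could be added.\<close>
  have uniq: "v = v'" if "{u, v} \<in> E" "{u, v'} \<in> E" "u \<in> \<Union>M" "v \<notin> \<Union>M" "v' \<notin> \<Union>M" for u v v'
  proof (rule ccontr)
    assume ne: "v \<noteq> v'"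
    have "u \<in> \<Union>E" using that by blast
    then obtain N where N: "N \<subseteq> E" "matching N" "card N = k" "u \<notin> \<Union>N"
      using missed k_def by metis
    have fN: "finite N" using N E finite_subset by blast
    have sub: "M \<union> N \<subseteq> E" using M N by simp
    from matching_exchange[OF fM M(2) fN N(2) ne that(4,5) N(4)] show False
    proof (elim disjE exE conjE bexE)
      fix L assume "L \<subseteq> M \<union> N" "matching L" "card L = Suc (card N)"
      moreover then have "L \<subseteq> E" using sub by blast
      ultimately show False using card_matching_le[of E L] E N k_def by simp
    next
      fix L x assume L: "L \<subseteq> M \<union> N" "matching L" "card L = card M" "u \<notin> \<Union>L"
        "x \<in> {v, v'}" "x \<noteq> u" "x \<notin> \<Union>L"
      have "{u, x} \<in> E" using L(5) that(1,2) by auto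
      moreover have "L \<subseteq> E" using L(1) sub by blast
      ultimately have "{u, x} \<inter> \<Union>L \<noteq> {}"
        using maximum_matching_meets[of E L "{u, x}"] E L(2,3) M(3) k_def by metis
      then show False using L by auto
    qed
  qed
  have "card B \<le> card (\<Union>M)"
  proof -
    have "\<forall>e. \<exists>u. e \<in> B \<longrightarrow> (\<exists>v. e = {u, v} \<and> u \<in> \<Union>M \<and> v \<notin> \<Union>M)"
      using B1 by blast
    then obtain h where h: "\<And>e. e \<in> B \<Longrightarrow> \<exists>v. e = {h e, v} \<and> h e \<in> \<Union>M \<and> v \<notin> \<Union>M"
      by metis
    have "inj_on h B"
    proof (rule inj_onI)
      fix e f assume ef: "e \<in> B" "f \<in> B" "h e = h f"
      define u where "u = h e"
      obtain v where v: "e = {u, v}" "u \<in> \<Union>M" "v \<notin> \<Union>M"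
        using h[OF ef(1)] unfolding u_def by blast
      obtain v' where v': "f = {u, v'}" "v' \<notin> \<Union>M"
        using h[OF ef(2)] unfolding ef(3)[symmetric] u_def by blast
      have "e \<in> E" "f \<in> E" using ef by (simp_all add: B_def)
      then have "v = v'" using uniq[of u v v'] v v' by simp
      then show "e = f" using v v' by simp
    qed
    moreover have "h ` B \<subseteq> \<Union>M" using h by blast
    ultimately show ?thesis using fU card_inj_on_le by blast
  qed
  \<comment> \<open>Incidences with \<open>\<Union>M\<close> are counted twice: an edge in
    \<open>A\<close> contributes two and an edge in \<open>B\<close> one. Adding
    \<open>card B \<le> 2 * k\<close> then counts every edge twice.\<close>
  moreover have "2 * card A + card B \<le> 2 * k * (2 * k)"
  proof -
    have "(\<Sum>v\<in>\<Union>M. card {e\<in>E. v \<in> e}) = (\<Sum>e\<in>E. card {v\<in>\<Union>M. v \<in> e})"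
      using sum_multicount_gen[OF fU E(1), of "\<lambda>v e. v \<in> e" "\<lambda>e. card {v\<in>\<Union>M. v \<in> e}"]
      by simp
    also have "\<dots> = (\<Sum>e\<in>A. card {v\<in>\<Union>M. v \<in> e}) + (\<Sum>e\<in>B. card {v\<in>\<Union>M. v \<in> e})"
      using AB by (simp add: sum.union_disjoint)
    also have "(\<Sum>e\<in>A. card {v\<in>\<Union>M. v \<in> e}) = (\<Sum>e\<in>A. 2)"
    proof (rule sum.cong)
      fix e assume e: "e \<in> A"
      then have "{v\<in>\<Union>M. v \<in> e} = e" by (auto simp: A_def)
      then show "card {v\<in>\<Union>M. v \<in> e} = 2" using E(2) e by (simp add: A_def)
    qed simp
    also have "(\<Sum>e\<in>B. card {v\<in>\<Union>M. v \<in> e}) = (\<Sum>e\<in>B. 1)"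
    proof (rule sum.cong)
      fix e assume e: "e \<in> B"
      then obtain u v where "e = {u, v}" "u \<in> \<Union>M" "v \<notin> \<Union>M" using B1 by blast
      then have "{v\<in>\<Union>M. v \<in> e} = {u}" by auto
      then show "card {v\<in>\<Union>M. v \<in> e} = 1" by simp
    qed simp
    finally have "2 * card A + card B = (\<Sum>v\<in>\<Union>M. card {e\<in>E. v \<in> e})" by simp
    also have "\<dots> \<le> (\<Sum>v\<in>\<Union>M. 2 * k)" by (rule sum_mono) (rule deg)
    also have "\<dots> = 2 * k * (2 * k)" using cU by simp
    finally show ?thesis .
  qed
  moreover have "card E = card A + card B" using AB by (simp add: card_Un_disjoint)
  ultimately show ?thesis using cU unfolding k_def[symmetric] by (simp add: algebra_simps)
qed

text \<open>Vertices that lie in every maximum matching are deleted one at a time, \<open>i\<close>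
  of them in all, until every vertex of an edge is missed by some maximum matching. For
  \<open>k\<close> the matching number, the first product is twice the number of edges of a complete
  graph on \<open>2 * (k - i) + 1\<close> vertices; the other terms are twice the largest possible
  number of edges that meet \<open>i\<close> given vertices.\<close>

lemma erdos_gallai_aux:
  fixes E :: "'a set set"
  assumes "finite V" "\<And>e. e \<in> E \<Longrightarrow> e \<subseteq> V \<and> card e = 2"
  shows "\<exists>i\<le>matching_number E. 2 * int (card E) \<le>
    (2 * (int (matching_number E) - int i) + 1) * (2 * (int (matching_number E) - int i))
    + 2 * int i * (int (card V) - int i) + int i * (int i - 1)"
  using assms
proof (induction "card V" arbitrary: V E rule: less_induct)
  case less
  have finE: "finite E" using less.prems by (meson PowI finite_Pow_iff finite_subset subsetI)
  show ?case
  proof (cases "\<forall>v\<in>\<Union>E. \<exists>M\<subseteq>E. matching M \<and> card M = matching_number E \<and> v \<notin> \<Union>M")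
    case True
    then have "2 * card E \<le> 2 * matching_number E * (2 * matching_number E + 1)"
      using card_le_if_all_vertices_missed[OF finE] less.prems(2) by blast
    then have "int (2 * card E) \<le> int (2 * matching_number E * (2 * matching_number E + 1))"
      by (simp only: of_nat_le_iff)
    then show ?thesis by (intro exI[of _ 0]) (simp add: algebra_simps)
  next
    case False
    then obtain v where v: "v \<in> \<Union>E"
      "\<And>M. M \<subseteq> E \<Longrightarrow> matching M \<Longrightarrow> card M = matching_number E \<Longrightarrow> v \<in> \<Union>M"
      by blast
    define E' where "E' = {e\<in>E. v \<notin> e}"
    define n where "n = card V"
    have vV: "v \<in> V" using v(1) less.prems(2) by blast
    have n: "card (V - {v}) = n - 1" "n > 0" "card (V - {v}) < card V"
      using vV less.prems(1) by (auto simp: n_def card_gt_0_iff intro!: diff_less)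
    have finE': "finite E'" "E' \<subseteq> E" using finE by (auto simp: E'_def)
    obtain M where M: "M \<subseteq> E'" "matching M" "card M = matching_number E'"
      using maximum_matching[OF finE'(1)] .
    \<comment> \<open>A maximum matching of \<open>E'\<close> misses \<open>v\<close>, so it cannot
      be a maximum matching of \<open>E\<close>.\<close>
    have lt: "matching_number E' < matching_number E"
      using v(2)[of M] M finE' finE card_matching_le[of E M] by (fastforce simp: E'_def)
    obtain i where i: "i \<le> matching_number E'" "2 * int (card E') \<le>
      (2 * (int (matching_number E') - int i) + 1) * (2 * (int (matching_number E') - int i))
      + 2 * int i * (int (card (V - {v})) - int i) + int i * (int i - 1)"
      using less.hyps[OF n(3), of E'] less.prems by (auto simp: E'_def)
    have "E - E' \<subseteq> (\<lambda>u. {v, u}) ` (V - {v})"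
    proof
      fix e assume "e \<in> E - E'"
      then have e: "e \<in> E" "v \<in> e" by (auto simp: E'_def)
      then have "e \<subseteq> V" "card e = 2" using less.prems(2) by auto
      then obtain u where "e = {v, u}" "u \<noteq> v" using e(2) by (auto simp: card_2_iff)
      then show "e \<in> (\<lambda>u. {v, u}) ` (V - {v})" using \<open>e \<subseteq> V\<close> by auto
    qed
    then have "card (E - E') \<le> n - 1" using surj_card_le less.prems(1) n by (metis finite_Diff)
    then have cE: "int (card E) \<le> int (card E') + int n - 1"
      using finE' n by (simp add: card_Diff_subset)
    define a where "a = int (matching_number E') - int i"
    define b where "b = int (matching_number E) - int (Suc i)"
    have ab: "0 \<le> a" "a \<le> b" using i(1) lt by (auto simp: a_def b_def)
    then have "(2 * a + 1) * (2 * a) \<le> (2 * b + 1) * (2 * b)" by (intro mult_mono) auto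
    moreover have n1: "int (card (V - {v})) = int n - 1" using n by simp
    moreover note cE i(2)[folded a_def, unfolded n1]
    ultimately have "2 * int (card E) \<le> (2 * b + 1) * (2 * b) + 2 * int (Suc i) * (int n - int (Suc i))
        + int (Suc i) * (int (Suc i) - 1)"
      by (simp add: algebra_simps)
    then show ?thesis using i(1) lt unfolding b_def n_def by (intro exI[of _ "Suc i"]) auto
  qed
qed

text \<open>The Erdos--Gallai bound on the number of edges in terms of the matching number; the
  intermediate bound is a convex function of \<open>i\<close>.\<close>

lemma erdos_gallai:
  fixes E :: "'a set set"
  assumes "finite V" "\<And>e. e \<in> E \<Longrightarrow> e \<subseteq> V \<and> card e = 2"
  defines "k \<equiv> real (matching_number E)"
  shows "real (card E) \<le> k * (2 * k + 1) \<or> 2 * real (card E) \<le> 2 * k * real (card V) - k * (k + 1)"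
proof -
  obtain j where j: "j \<le> matching_number E" "2 * int (card E) \<le>
    (2 * (int (matching_number E) - int j) + 1) * (2 * (int (matching_number E) - int j))
    + 2 * int j * (int (card V) - int j) + int j * (int j - 1)"
    using erdos_gallai_aux[OF assms(1,2)] by blast
  define i where "i = real j"
  define n where "n = real (card V)"
  have i: "0 \<le> i" "i \<le> k" using j by (simp_all add: i_def k_def)
  have "of_int (2 * int (card E)) \<le> (of_int (
    (2 * (int (matching_number E) - int j) + 1) * (2 * (int (matching_number E) - int j))
    + 2 * int j * (int (card V) - int j) + int j * (int j - 1)) :: real)"
    using j(2) by (simp only: of_int_le_iff)
  then have *: "2 * real (card E) \<le> (2 * (k - i) + 1) * (2 * (k - i)) + 2 * i * (n - i) + i * (i - 1)"
    by (simp add: i_def k_def n_def)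
  also have "\<dots> = 2 * (k * (2 * k + 1)) + i * (3 * i + (2 * n - 8 * k - 3))"
    by (simp add: algebra_simps)
  finally have **: "2 * real (card E) \<le> 2 * (k * (2 * k + 1)) + i * (3 * i + (2 * n - 8 * k - 3))" .
  show ?thesis
  \<comment> \<open>The excess over the value at \<open>i = 0\<close> is \<open>i\<close> times an
    increasing linear factor. If this factor is nonpositive, the value at \<open>0\<close> is a
    bound; otherwise the product increases up to \<open>i = k\<close>.\<close>
  proof (cases "3 * i + (2 * n - 8 * k - 3) \<le> 0")
    case True
    then have "i * (3 * i + (2 * n - 8 * k - 3)) \<le> 0" using i by (simp add: mult_nonneg_nonpos)
    then show ?thesis using ** by simp
  next
    case False
    then have "i * (3 * i + (2 * n - 8 * k - 3)) \<le> k * (3 * k + (2 * n - 8 * k - 3))"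
      using i by (intro mult_mono) auto
    with ** have "2 * real (card E) \<le> 2 * (k * (2 * k + 1)) + k * (3 * k + (2 * n - 8 * k - 3))"
      by simp
    also have "\<dots> = 2 * k * n - k * (k + 1)" by (simp add: algebra_simps)
    finally show ?thesis by (simp add: n_def)
  qed
qed

lemma matching_Un_card:
  "matching M \<Longrightarrow> finite (\<Union>M) \<Longrightarrow> finite M \<and> card (\<Union>M) = 2 * card M"
  by (simp add: matching_card_Union finite_UnionD)

text \<open>The number of uncovered vertices is even, so as long as one of them is left there are
  two, and any two may be paired.\<close>

lemma perfect_matching_extension:
  assumes "finite S" "even (card S)" "matching M" "\<Union>M \<subseteq> S"
  obtains Q where "M \<subseteq> Q" "matching Q" "\<Union>Q = S"
proof -
  have "\<exists>Q. M \<subseteq> Q \<and> matching Q \<and> \<Union>Q = S" using assms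
  proof (induction "card (S - \<Union>M)" arbitrary: M rule: less_induct)
    case less
    show ?case
    proof (cases "\<Union>M = S")
      case True then show ?thesis using less.prems by blast
    next
      case False
      then obtain x where x: "x \<in> S" "x \<notin> \<Union>M" using less.prems by blast
      have "even (card (\<Union>M))"
        using matching_Un_card less.prems finite_subset by (metis dvd_triv_left)
      then have "S \<noteq> insert x (\<Union>M)"
        using x less.prems by (metis card_insert_disjoint even_Suc finite_subset)
      then obtain y where y: "y \<in> S" "y \<notin> \<Union>M" "y \<noteq> x" using x less.prems by blast
      have m: "matching (insert {x, y} M)"
        using less.prems x y by (intro matching_insert) auto
      have "S - \<Union>(insert {x, y} M) \<subset> S - \<Union>M" using x by blast
      then have "card (S - \<Union>(insert {x, y} M)) < card (S - \<Union>M)"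
        using less.prems(1) by (meson finite_Diff psubset_card_mono)
      moreover have "\<Union>(insert {x, y} M) \<subseteq> S" using x y less.prems by auto
      ultimately obtain Q where "insert {x, y} M \<subseteq> Q" "matching Q" "\<Union>Q = S"
        using less.hyps[of "insert {x, y} M"] less.prems m by blast
      then show ?thesis by blast
    qed
  qed
  then show thesis using that by blast
qed

subsection \<open>Random permutations that respect matchings\<close>

text \<open>The bijection is glued together from bijections between single edges; the remaining
  vertices are equally many on both sides and are mapped arbitrarily. This makes the set of
  permutations to be averaged over nonempty.\<close>

lemma matchings_isomorphic:
  assumes "finite P" "matching P" "\<Union>P \<subseteq> A" "matching Q" "\<Union>Q \<subseteq> B"
    "finite A" "finite B" "card A = card B" "card P = card Q"
  shows "\<exists>f. bij_betw f A B \<and> (`) f ` P = Q"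
  using assms
proof (induction P arbitrary: A B Q rule: finite_induct)
  case empty
  have "finite Q" using empty by (meson finite_UnionD finite_subset)
  then have "Q = {}" using empty by simp
  then show ?case using finite_same_card_bij empty by auto
next
  case (insert p P)
  have "Q \<noteq> {}" using insert by auto
  then obtain q where q: "q \<in> Q" by blast
  have fQ: "finite Q" using insert by (meson finite_UnionD finite_subset)
  have P: "matching P" "card p = 2" "p \<inter> \<Union>P = {}" "p \<subseteq> A"
    using insert.prems insert.hyps matching_subset[of _ P]
    by (auto simp: matching_def pairwise_insert disjnt_def)
  have Q: "matching (Q - {q})" "card q = 2" "\<Union>(Q - {q}) = \<Union>Q - q" "q \<subseteq> B"
    using insert.prems q matching_subset[of Q "Q - {q}"] matching_Union_remove[of Q q]
    by (auto simp: matching_def)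
  have "finite p" "finite q" using P Q by (simp_all add: card_ge_0_finite)
  then have "card (A - p) = card (B - q)"
    using P Q insert.prems by (simp add: card_Diff_subset)
  then have "\<exists>f. bij_betw f (A - p) (B - q) \<and> (`) f ` P = Q - {q}"
    using insert.prems insert.hyps P Q q fQ by (intro insert.IH) auto
  then obtain f where f: "bij_betw f (A - p) (B - q)" "(`) f ` P = Q - {q}" by blast
  obtain g where g: "bij_betw g p q"
    using finite_same_card_bij[of p q] P Q \<open>finite p\<close> \<open>finite q\<close> by auto
  define h where "h = (\<lambda>x. if x \<in> p then g x else f x)"
  have "bij_betw h (p \<union> (A - p)) (q \<union> (B - q))"
    unfolding h_def using g f by (intro bij_betw_disjoint_Un) auto
  moreover have "p \<union> (A - p) = A" "q \<union> (B - q) = B" using P Q by auto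
  moreover have "h ` p = q" using g by (simp add: h_def bij_betw_def)
  moreover have "(`) h ` P = (`) f ` P"
  proof (rule image_cong)
    fix e assume "e \<in> P"
    then have "e \<inter> p = {}" using P by blast
    then show "h ` e = f ` e" by (auto simp: h_def image_iff)
  qed simp
  ultimately have "bij_betw h A B" "(`) h ` insert p P = Q" using f q by auto
  then show ?case by blast
qed

section \<open>Partner maps and automorphisms of a matching\<close>

lemma matching_involution:
  assumes "matching Q"
  obtains \<tau> where "\<And>x. x \<in> \<Union>Q \<Longrightarrow> {x, \<tau> x} \<in> Q" "\<And>x. x \<in> \<Union>Q \<Longrightarrow> \<tau> x \<noteq> x"
    "\<And>x. x \<in> \<Union>Q \<Longrightarrow> \<tau> (\<tau> x) = x" "\<And>x. x \<in> \<Union>Q \<Longrightarrow> \<tau> x \<in> \<Union>Q"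
proof -
  have "\<forall>x. \<exists>y. x \<in> \<Union>Q \<longrightarrow> {x, y} \<in> Q \<and> y \<noteq> x" using matching_edge_cases[OF assms] by metis
  then obtain \<tau> where t: "\<And>x. x \<in> \<Union>Q \<Longrightarrow> {x, \<tau> x} \<in> Q" "\<And>x. x \<in> \<Union>Q \<Longrightarrow> \<tau> x \<noteq> x"
    by metis
  have U: "\<tau> x \<in> \<Union>Q" if "x \<in> \<Union>Q" for x using t(1)[OF that] by blast
  have "\<tau> (\<tau> x) = x" if x: "x \<in> \<Union>Q" for x
  proof -
    have "{\<tau> x, \<tau> (\<tau> x)} = {x, \<tau> x}"
      using matching_eqI[OF assms t(1)[OF U[OF x]] t(1)[OF x], of "\<tau> x"] by simp
    then show ?thesis using t(2)[OF U[OF x]] t(2)[OF x] by (auto simp: doubleton_eq_iff)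
  qed
  then show thesis using that t U by blast
qed

text \<open>Exchanging \<open>x\<close> with \<open>y\<close> and their partners with each other
  commutes with the partner map \<open>\<tau>\<close> and thus preserves \<open>Q\<close>. The fixed
  points are recorded because two such exchanges are composed for pairs outside of
  \<open>Q\<close>.\<close>

lemma matching_automorphism_swap:
  assumes Q: "matching Q" and fin: "finite (\<Union>Q)"
    and t: "\<And>x. x \<in> \<Union>Q \<Longrightarrow> {x, \<tau> x} \<in> Q" "\<And>x. x \<in> \<Union>Q \<Longrightarrow> \<tau> x \<noteq> x"
    "\<And>x. x \<in> \<Union>Q \<Longrightarrow> \<tau> (\<tau> x) = x" "\<And>x. x \<in> \<Union>Q \<Longrightarrow> \<tau> x \<in> \<Union>Q"
    and xy: "x \<in> \<Union>Q" "y \<in> \<Union>Q"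
  shows "\<exists>g. g permutes \<Union>Q \<and> (`) g ` Q = Q \<and> (\<forall>z\<in>\<Union>Q. g (\<tau> z) = \<tau> (g z)) \<and>
    g x = y \<and> (\<forall>z. z \<notin> {x, \<tau> x, y, \<tau> y} \<longrightarrow> g z = z)"
proof -
  \<comment> \<open>If \<open>y\<close> is the partner of \<open>x\<close>, the two transpositions
    coincide and would cancel, so only one is taken.\<close>
  define g where
    "g = (if y = \<tau> x then transpose x y else transpose x y \<circ> transpose (\<tau> x) (\<tau> y))"
  have perm: "g permutes \<Union>Q"
    unfolding g_def using xy t(4) by (auto intro!: permutes_swap_id permutes_compose)
  have gx: "g x = y"
    using t(2)[OF xy(1)] t(3)[OF xy(1)] t(3)[OF xy(2)] by (auto simp: g_def transpose_def)
  have out: "g z = z" if "z \<notin> {x, \<tau> x, y, \<tau> y}" for z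
    using that by (auto simp: g_def transpose_def)
  have comm: "g (\<tau> z) = \<tau> (g z)" if z: "z \<in> \<Union>Q" for z
  proof (cases "z \<in> {x, \<tau> x, y, \<tau> y}")
    case True
    then show ?thesis
      using t(2)[OF xy(1)] t(2)[OF xy(2)] t(3)[OF xy(1)] t(3)[OF xy(2)]
      by (auto simp: g_def transpose_def)
  next
    case False
    then have "\<tau> z \<notin> {x, \<tau> x, y, \<tau> y}" using t(3)[OF z] t(3)[OF xy(1)] t(3)[OF xy(2)] by auto
    then show ?thesis using out False by simp
  qed
  have "g ` e \<in> Q" if e: "e \<in> Q" for e
  proof -
    obtain z where z: "z \<in> e" using Q e by (fastforce simp: matching_def)
    then have zU: "z \<in> \<Union>Q" using e by blast
    then have "e = {z, \<tau> z}" using matching_eqI[OF Q e t(1)[OF zU] z] by simp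
    then have "g ` e = {g z, \<tau> (g z)}" using comm[OF zU] by simp
    moreover have "g z \<in> \<Union>Q" using permutes_in_image[OF perm] zU by blast
    ultimately show ?thesis using t(1) by simp
  qed
  then have "(`) g ` Q \<subseteq> Q" by blast
  moreover have "inj_on ((`) g) Q" using permutes_inj[OF perm] by (meson inj_on_subset inj_image_eq_iff inj_onI)
  moreover have "finite Q" using fin finite_UnionD by blast
  ultimately have "(`) g ` Q = Q" by (simp add: endo_inj_surj)
  then show ?thesis using perm comm gx out by blast
qed

lemma matching_automorphism_edge:
  assumes Q: "matching Q" and fin: "finite (\<Union>Q)" and ef: "e \<in> Q" "f \<in> Q"
  shows "\<exists>g. g permutes \<Union>Q \<and> (`) g ` Q = Q \<and> g ` e = f"
proof -
  obtain \<tau> where t: "\<And>x. x \<in> \<Union>Q \<Longrightarrow> {x, \<tau> x} \<in> Q" "\<And>x. x \<in> \<Union>Q \<Longrightarrow> \<tau> x \<noteq> x"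
    "\<And>x. x \<in> \<Union>Q \<Longrightarrow> \<tau> (\<tau> x) = x" "\<And>x. x \<in> \<Union>Q \<Longrightarrow> \<tau> x \<in> \<Union>Q"
    using matching_involution[OF Q] by blast
  obtain x y where xy: "x \<in> e" "y \<in> f" using Q ef by (fastforce simp: matching_def)
  then have "x \<in> \<Union>Q" "y \<in> \<Union>Q" using ef by auto
  then obtain g where g: "g permutes \<Union>Q" "(`) g ` Q = Q" "g x = y"
    using matching_automorphism_swap[OF Q fin t] by blast
  have "g ` e \<in> Q" using g ef by blast
  then have "g ` e = f" using matching_eqI[OF Q _ ef(2)] xy g by blast
  then show ?thesis using g by blast
qed

text \<open>One exchange moves \<open>u\<close> to \<open>x\<close>, a second one moves the image of
  \<open>v\<close> to \<open>y\<close>. The second fixes \<open>x\<close>, because neither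
  \<open>y\<close> nor the image of \<open>v\<close> is \<open>x\<close> or its partner.\<close>

lemma matching_automorphism_nonedge:
  assumes Q: "matching Q" and fin: "finite (\<Union>Q)"
    and e: "e \<subseteq> \<Union>Q" "card e = 2" "e \<notin> Q" and f: "f \<subseteq> \<Union>Q" "card f = 2" "f \<notin> Q"
  shows "\<exists>g. g permutes \<Union>Q \<and> (`) g ` Q = Q \<and> g ` e = f"
proof -
  obtain \<tau> where t: "\<And>x. x \<in> \<Union>Q \<Longrightarrow> {x, \<tau> x} \<in> Q" "\<And>x. x \<in> \<Union>Q \<Longrightarrow> \<tau> x \<noteq> x"
    "\<And>x. x \<in> \<Union>Q \<Longrightarrow> \<tau> (\<tau> x) = x" "\<And>x. x \<in> \<Union>Q \<Longrightarrow> \<tau> x \<in> \<Union>Q"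
    using matching_involution[OF Q] by blast
  obtain u v where uv: "e = {u, v}" "u \<noteq> v" using e by (auto simp: card_2_iff)
  obtain x y where xy: "f = {x, y}" "x \<noteq> y" using f by (auto simp: card_2_iff)
  have U: "u \<in> \<Union>Q" "v \<in> \<Union>Q" "x \<in> \<Union>Q" "y \<in> \<Union>Q" using e f uv xy by auto
  have vu: "v \<noteq> \<tau> u" using t(1)[OF U(1)] e uv by auto
  have yx: "y \<noteq> \<tau> x" using t(1)[OF U(3)] f xy by auto
  obtain g where g: "g permutes \<Union>Q" "(`) g ` Q = Q" "\<And>z. z \<in> \<Union>Q \<Longrightarrow> g (\<tau> z) = \<tau> (g z)" "g u = x"
    using matching_automorphism_swap[OF Q fin t U(1) U(3)] by blast
  have gv: "g v \<in> \<Union>Q" using permutes_in_image[OF g(1)] U by blast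
  have inj: "g a = g b \<longleftrightarrow> a = b" for a b using permutes_inj[OF g(1)] by (simp add: inj_eq)
  have "g v \<noteq> x" "g v \<noteq> \<tau> x" using g(3)[OF U(1)] g(4) inj uv vu by metis+
  obtain h where h: "h permutes \<Union>Q" "(`) h ` Q = Q" "h (g v) = y"
    "\<And>z. z \<notin> {g v, \<tau> (g v), y, \<tau> y} \<Longrightarrow> h z = z"
    using matching_automorphism_swap[OF Q fin t gv U(4)] by blast
  have "x \<notin> {g v, \<tau> (g v), y, \<tau> y}"
    using \<open>g v \<noteq> x\<close> \<open>g v \<noteq> \<tau> x\<close> xy yx t(3)[OF U(3)] t(3)[OF U(4)] t(3)[OF gv] by auto
  then have "h x = x" using h by blast
  then have "(h \<circ> g) ` e = f" using uv xy h g by simp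
  moreover have "(h \<circ> g) permutes \<Union>Q" by (rule permutes_compose[OF g(1) h(1)])
  moreover have "(`) (h \<circ> g) ` Q = Q"
  proof -
    have "(`) (h \<circ> g) ` Q = (`) h ` (`) g ` Q" by (simp add: image_comp comp_def)
    then show ?thesis using g h by simp
  qed
  ultimately show ?thesis by blast
qed

text \<open>Composition with \<open>g\<close> embeds the fibre over \<open>f\<close> into the fibre
  over \<open>f'\<close>, so all fibres over \<open>X\<close> have the same size. Multiplying out
  keeps this an identity of natural numbers.\<close>

lemma transitive_fiber_count:
  assumes fin: "finite R" "finite X"
    and im: "\<And>\<pi>. \<pi> \<in> R \<Longrightarrow> \<pi> ` e \<in> X"
    and trans: "\<And>f f'. f \<in> X \<Longrightarrow> f' \<in> X \<Longrightarrow> \<exists>g. inj g \<and> g ` f = f' \<and> (\<forall>\<pi>\<in>R. g \<circ> \<pi> \<in> R)"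
    and F: "F \<subseteq> X"
  shows "card {\<pi>\<in>R. \<pi> ` e \<in> F} * card X = card R * card F"
proof -
  define A where "A f = {\<pi>\<in>R. \<pi> ` e = f}" for f
  have finA: "finite (A f)" for f using fin by (simp add: A_def)
  have le: "card (A f) \<le> card (A f')" if ff: "f \<in> X" "f' \<in> X" for f f'
  proof -
    obtain g where g: "inj g" "g ` f = f'" "\<And>\<pi>. \<pi> \<in> R \<Longrightarrow> g \<circ> \<pi> \<in> R" using trans ff by blast
    have "inj_on ((\<circ>) g) (A f)" using fun.inj_map[OF g(1)] inj_on_subset by blast
    moreover have "(\<circ>) g ` A f \<subseteq> A f'" using g by (auto simp: A_def image_comp[symmetric])
    ultimately show ?thesis using finA card_inj_on_le by blast
  qed
  have count: "card {\<pi>\<in>R. \<pi> ` e \<in> Y} = (\<Sum>f\<in>Y. card (A f))" if "Y \<subseteq> X" for Y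
  proof -
    have "{\<pi>\<in>R. \<pi> ` e \<in> Y} = (\<Union>f\<in>Y. A f)" by (auto simp: A_def)
    moreover have "finite Y" using that fin finite_subset by blast
    ultimately show ?thesis using finA by (subst card_UN_disjoint[symmetric]) (auto simp: A_def)
  qed
  show ?thesis
  proof (cases "X = {}")
    case True then show ?thesis using F by simp
  next
    case False
    then obtain f0 where f0: "f0 \<in> X" by blast
    have eq: "card (A f) = card (A f0)" if "f \<in> X" for f using le f0 that by (meson le_antisym)
    have sum_eq: "(\<Sum>f\<in>Y. card (A f)) = card Y * card (A f0)" if "Y \<subseteq> X" for Y
    proof -
      have "(\<Sum>f\<in>Y. card (A f)) = (\<Sum>f\<in>Y. card (A f0))" using eq that by (intro sum.cong) auto
      then show ?thesis by simp
    qed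
    have "R = {\<pi>\<in>R. \<pi> ` e \<in> X}" using im by blast
    then have "card R = card X * card (A f0)" using count[of X] sum_eq[of X] by simp
    then show ?thesis using count[OF F] sum_eq[OF F] by simp
  qed
qed

lemma image_not_in_image_family:
  "inj \<pi> \<Longrightarrow> (`) \<pi> ` P = Q \<Longrightarrow> e \<notin> P \<Longrightarrow> \<pi> ` e \<notin> Q"
  by (metis imageE inj_image_eq_iff)

text \<open>Averages over all permutations that map \<open>P\<close> onto \<open>Q\<close>: under a uniformly random one an
  edge in \<open>P\<close> becomes a uniformly random edge in \<open>Q\<close>, and every other pair in \<open>\<Union>P\<close> becomes
  a uniformly random one of the \<open>2 * t * (t - 1)\<close> pairs in \<open>\<Union>Q\<close> outside of \<open>Q\<close>.\<close>

lemma matching_average: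
  fixes V :: "'a set" and P Q H F :: "'a set set"
  assumes V: "finite V" and P: "matching P" "\<Union>P \<subseteq> V" and Q: "matching Q" "\<Union>Q \<subseteq> V"
    and t: "card P = t" "card Q = t" "t \<ge> 2"
    and H: "\<And>e. e \<in> H \<Longrightarrow> e \<subseteq> \<Union>P \<and> card e = 2"
    and F: "\<And>e. e \<in> F \<Longrightarrow> e \<subseteq> \<Union>Q \<and> card e = 2"
  shows "\<exists>\<pi>. \<pi> permutes V \<and>
    real (card {e\<in>H. \<pi> ` e \<in> F}) \<ge> real (card (H \<inter> P)) * real (card (F \<inter> Q)) / real t
      + real (card (H - P)) * real (card (F - Q)) / (2 * real t * (real t - 1))"
proof -
  define R where "R = {\<pi>. \<pi> permutes V \<and> (`) \<pi> ` P = Q}"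
  define X where "X = {e. e \<subseteq> \<Union>Q \<and> card e = 2} - Q"
  have finU: "finite (\<Union>P)" "finite (\<Union>Q)" using V P Q finite_subset by blast+
  have finPQ: "finite P" "finite Q" using finU finite_UnionD by blast+
  have finH: "finite H" by (rule finite_subset[of H "Pow (\<Union>P)"]) (use H finU in auto)
  have finX: "finite X" using finU by (auto simp: X_def intro: finite_subset[of _ "Pow (\<Union>Q)"])
  have finR: "finite R" using finite_permutations[OF V] by (simp add: R_def)
  have Qsub: "Q \<subseteq> {e. e \<subseteq> \<Union>Q \<and> card e = 2}" using Q(1) by (auto simp: matching_def)
  have "card X = (2 * t choose 2) - t"
    unfolding X_def using card_Diff_subset[OF finPQ(2) Qsub] n_subsets[OF finU(2), of 2]
      matching_card_Union[OF Q(1) finPQ(2)] t by simp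
  moreover have "2 * t choose 2 = 2 * t * (t - 1) + t"
    using t(3) by (cases t) (simp_all add: choose_two algebra_simps)
  ultimately have cX: "card X = 2 * t * (t - 1)" by simp
  then have cX': "real (card X) = 2 * real t * (real t - 1)" using t(3) by (simp add: of_nat_diff)
  \<comment> \<open>Automorphisms of \<open>Q\<close> act on \<open>R\<close> by composition;
    together with their transitivity on \<open>Q\<close> and on \<open>X\<close> this makes the
    fibres equally large.\<close>
  have lift: "\<forall>\<pi>\<in>R. g \<circ> \<pi> \<in> R" if g: "g permutes \<Union>Q" "(`) g ` Q = Q" for g
  proof
    fix \<pi> assume "\<pi> \<in> R"
    then have p: "\<pi> permutes V" "(`) \<pi> ` P = Q" by (simp_all add: R_def)
    have "g permutes V" using permutes_subset[OF g(1) Q(2)] .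
    then have "g \<circ> \<pi> permutes V" using permutes_compose p by blast
    moreover have "(`) (g \<circ> \<pi>) ` P = (`) g ` (`) \<pi> ` P" by (simp add: image_comp comp_def)
    ultimately show "g \<circ> \<pi> \<in> R" using p g by (simp add: R_def)
  qed
  have "R \<noteq> {}"
  proof -
    obtain f where f: "bij_betw f V V" "(`) f ` P = Q"
      using matchings_isomorphic[OF finPQ(1) P Q V V] t by auto
    define \<pi> where "\<pi> = (\<lambda>x. if x \<in> V then f x else x)"
    have "bij_betw \<pi> V V" using f(1) by (subst bij_betw_cong[of V \<pi> f]) (simp_all add: \<pi>_def)
    then have "\<pi> permutes V" by (rule bij_imp_permutes) (simp add: \<pi>_def)
    moreover have "(`) \<pi> ` P = (`) f ` P"
      using P by (intro image_cong refl) (auto simp: \<pi>_def)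
    ultimately show ?thesis using f by (auto simp: R_def)
  qed
  then have cardR: "card R > 0" using finR by (simp add: card_gt_0_iff)
  have fiberP: "real (card {\<pi>\<in>R. \<pi> ` e \<in> F}) = real (card R) * (real (card (F \<inter> Q)) / real t)"
    if e: "e \<in> H \<inter> P" for e
  proof -
    have im: "\<pi> ` e \<in> Q" if "\<pi> \<in> R" for \<pi> using that e by (auto simp: R_def)
    then have "{\<pi>\<in>R. \<pi> ` e \<in> F} = {\<pi>\<in>R. \<pi> ` e \<in> F \<inter> Q}" by blast
    moreover have "card {\<pi>\<in>R. \<pi> ` e \<in> F \<inter> Q} * card Q = card R * card (F \<inter> Q)"
      using finR finPQ(2) im
    proof (rule transitive_fiber_count)
      fix f f' assume "f \<in> Q" "f' \<in> Q"
      then show "\<exists>g. inj g \<and> g ` f = f' \<and> (\<forall>\<pi>\<in>R. g \<circ> \<pi> \<in> R)"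
        using matching_automorphism_edge[OF Q(1) finU(2)] lift permutes_inj by metis
    qed auto
    ultimately have "card {\<pi>\<in>R. \<pi> ` e \<in> F} * t = card R * card (F \<inter> Q)" using t by simp
    then have "real (card {\<pi>\<in>R. \<pi> ` e \<in> F}) * real t = real (card R) * real (card (F \<inter> Q))"
      by (simp only: of_nat_mult[symmetric])
    then show ?thesis using t(3) by (simp add: field_simps)
  qed
  have fiberX: "real (card {\<pi>\<in>R. \<pi> ` e \<in> F})
      = real (card R) * (real (card (F - Q)) / (2 * real t * (real t - 1)))"
    if e: "e \<in> H - P" for e
  proof -
    have im: "\<pi> ` e \<in> X" if "\<pi> \<in> R" for \<pi>
    proof -
      have p: "\<pi> permutes V" "(`) \<pi> ` P = Q" using that by (simp_all add: R_def)
      have "\<pi> ` e \<notin> Q" using image_not_in_image_family[OF permutes_inj[OF p(1)] p(2)] e by blast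
      moreover have "card (\<pi> ` e) = 2"
        using card_image[OF inj_on_subset[OF permutes_inj[OF p(1)]]] H e by simp
      moreover have "\<pi> ` e \<subseteq> \<Union>Q" using H[of e] e p(2) by blast
      ultimately show ?thesis by (simp add: X_def)
    qed
    then have "{\<pi>\<in>R. \<pi> ` e \<in> F} = {\<pi>\<in>R. \<pi> ` e \<in> F - Q}" by (auto simp: X_def)
    moreover have "card {\<pi>\<in>R. \<pi> ` e \<in> F - Q} * card X = card R * card (F - Q)"
      using finR finX im
    proof (rule transitive_fiber_count)
      fix f f' assume "f \<in> X" "f' \<in> X"
      then have "\<exists>g. g permutes \<Union>Q \<and> (`) g ` Q = Q \<and> g ` f = f'"
        unfolding X_def by (intro matching_automorphism_nonedge[OF Q(1) finU(2)]) auto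
      then show "\<exists>g. inj g \<and> g ` f = f' \<and> (\<forall>\<pi>\<in>R. g \<circ> \<pi> \<in> R)"
        using lift permutes_inj by metis
    qed (use F in \<open>auto simp: X_def\<close>)
    ultimately have "card {\<pi>\<in>R. \<pi> ` e \<in> F} * card X = card R * card (F - Q)" by simp
    then have "real (card {\<pi>\<in>R. \<pi> ` e \<in> F}) * real (card X) = real (card R) * real (card (F - Q))"
      by (simp only: of_nat_mult[symmetric])
    moreover have "real (card X) \<noteq> 0" unfolding cX' using t(3) by simp
    ultimately show ?thesis unfolding cX'[symmetric] by (simp add: field_simps)
  qed
  define b where "b = real (card (H \<inter> P)) * real (card (F \<inter> Q)) / real t
      + real (card (H - P)) * real (card (F - Q)) / (2 * real t * (real t - 1))"
  \<comment> \<open>Changing the order of summation turns the total over all permutations into a sum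
    of fibre sizes; some permutation reaches the average \<open>b\<close>.\<close>
  have "(\<Sum>\<pi>\<in>R. card {e\<in>H. \<pi> ` e \<in> F}) = (\<Sum>e\<in>H. card {\<pi>\<in>R. \<pi> ` e \<in> F})"
    by (rule sum_multicount_gen[OF finR finH]) simp
  then have "(\<Sum>\<pi>\<in>R. real (card {e\<in>H. \<pi> ` e \<in> F})) = (\<Sum>e\<in>H. real (card {\<pi>\<in>R. \<pi> ` e \<in> F}))"
    by (simp only: of_nat_sum[symmetric])
  also have "\<dots> = (\<Sum>e\<in>H \<inter> P. real (card {\<pi>\<in>R. \<pi> ` e \<in> F}))
      + (\<Sum>e\<in>H - P. real (card {\<pi>\<in>R. \<pi> ` e \<in> F}))"
    using finH by (subst sum.union_disjoint[symmetric]) (auto intro: sum.cong)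
  also have "\<dots> = real (card R) * b"
    using fiberP fiberX by (simp add: b_def algebra_simps)
  finally have sum: "(\<Sum>\<pi>\<in>R. real (card {e\<in>H. \<pi> ` e \<in> F})) = real (card R) * b" .
  have "\<exists>\<pi>\<in>R. b \<le> real (card {e\<in>H. \<pi> ` e \<in> F})"
  proof (rule ccontr)
    assume "\<not> ?thesis"
    then have "(\<Sum>\<pi>\<in>R. real (card {e\<in>H. \<pi> ` e \<in> F})) < (\<Sum>\<pi>\<in>R. b)"
      using finR \<open>R \<noteq> {}\<close> by (intro sum_strict_mono) auto
    then show False using sum by simp
  qed
  then show ?thesis unfolding b_def R_def by blast
qed

subsection \<open>Estimates\<close>

text \<open>The threshold is the common value of both Erdos--Gallai bounds at
  \<open>k = (2 * n - 3) / 5\<close>.\<close>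

lemma erdos_gallai_threshold:
  fixes n k p :: real
  assumes "n \<ge> 4" "0 \<le> k" "2 * k \<le> n"
    and eg: "p \<le> k * (2 * k + 1) \<or> 2 * p \<le> 2 * k * n - k * (k + 1)"
  shows "p \<le> (8 * n ^ 2 - 14 * n + 3) / 25 \<Longrightarrow> 2 * p \<le> 2 * k * n - k * (k + 1)"
    and "\<not> p \<le> (8 * n ^ 2 - 14 * n + 3) / 25 \<Longrightarrow> p \<le> k * (2 * k + 1)"
proof -
  define k0 where "k0 = (2 * n - 3) / 5"
  define q where "q = (8 * n ^ 2 - 14 * n + 3) / 25"
  \<comment> \<open>The second Erdos--Gallai bound takes the value \<open>2 * q\<close> at
    \<open>k0\<close> and crosses twice the first one there. If the desired bound fails, the other
    one holds, which puts \<open>k\<close> on one side of \<open>k0\<close>; then the second bound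
    lies on the wrong side of \<open>2 * q\<close>.\<close>
  have diff: "2 * k * n - k * (k + 1) - 2 * q = (k - k0) * (2 * n - k - k0 - 1)"
    unfolding k0_def q_def power2_eq_square
    by (simp add: algebra_simps add_divide_distrib diff_divide_distrib)
  have pos: "2 * n - k - k0 - 1 > 0" using assms unfolding k0_def by argo
  have diff2: "2 * (k * (2 * k + 1)) - (2 * k * n - k * (k + 1)) = 5 * k * (k - k0)"
    by (simp add: k0_def field_simps)
  show "2 * p \<le> 2 * k * n - k * (k + 1)" if "p \<le> q"
  proof (rule ccontr)
    assume c: "\<not> ?thesis"
    then have "0 < 5 * k * (k - k0)" using eg diff2 by linarith
    then have "k - k0 > 0" using assms by (simp add: zero_less_mult_iff)
    then have "(k - k0) * (2 * n - k - k0 - 1) > 0" using pos by simp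
    then show False using diff c that by linarith
  qed
  show "p \<le> k * (2 * k + 1)" if "\<not> p \<le> q"
  proof (rule ccontr)
    assume c: "\<not> ?thesis"
    then have "5 * k * (k - k0) < 0" using eg diff2 by linarith
    then have "k - k0 < 0" using assms by (simp add: mult_less_0_iff)
    then have "(k - k0) * (2 * n - k - k0 - 1) < 0" using pos by (simp add: mult_neg_pos)
    then show False using diff c that eg by linarith
  qed
qed

text \<open>A clique on \<open>2 * k + 1\<close> vertices has density about
  \<open>(2 * k / n) ^ 2\<close>, whence the value \<open>sqrt d\<close>. The rounded form is
  \<open>d * (n - 1) ^ 2 \<le> (2 * k + 1) ^ 2\<close>.\<close>

lemma matching_density_clique:
  fixes n k d :: real
  assumes n: "n \<ge> 4" "0 \<le> k" and d: "0 \<le> d" "d \<le> 1" and p: "d * (n * (n - 1)) / 2 \<le> k * (2 * k + 1)"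
  shows "(n - 1) * sqrt d \<le> 2 * k + 1" "d \<le> sqrt d" "sqrt d \<le> 1"
proof -
  have "(n - 1) * (n - 1) \<le> n * (n - 1)" using n by (intro mult_right_mono) auto
  then have "d * ((n - 1) * (n - 1)) \<le> d * (n * (n - 1))" using d by (intro mult_left_mono) auto
  also have "\<dots> \<le> 2 * (k * (2 * k + 1))" using p by simp
  also have "\<dots> \<le> (2 * k + 1) ^ 2" using n by (simp add: power2_eq_square algebra_simps)
  finally have "((n - 1) * sqrt d) ^ 2 \<le> (2 * k + 1) ^ 2"
    using d by (simp add: power_mult_distrib power2_eq_square algebra_simps)
  then show "(n - 1) * sqrt d \<le> 2 * k + 1" using n by (simp add: power2_le_iff_abs_le)
  show "sqrt d \<le> 1" using d by simp
  have "d = sqrt d * sqrt d" using d by simp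
  also have "\<dots> \<le> sqrt d * 1" using d by (intro mult_left_mono) auto
  finally show "d \<le> sqrt d" by simp
qed

text \<open>The bound comes from the graph of all edges that meet \<open>k\<close> given vertices.
  With \<open>s = sqrt (1 - d)\<close> it says that \<open>n - k\<close> is at most about
  \<open>n * s\<close>, so \<open>2 * k / n\<close> is at least about
  \<open>2 - 2 * s\<close>.\<close>

lemma matching_density_star:
  fixes n k d :: real
  assumes n: "n \<ge> 4" "0 \<le> k" "2 * k \<le> n" and d: "0 \<le> d" "d \<le> 1"
    and p: "d * (n * (n - 1)) \<le> 2 * k * n - k * (k + 1)"
    and thr: "d * (n * (n - 1)) / 2 \<le> (8 * n ^ 2 - 14 * n + 3) / 25"
  shows "(n - 1) * (2 - 2 * sqrt (1 - d)) \<le> 2 * k + 1" "d \<le> 2 - 2 * sqrt (1 - d)"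
    "2 - 2 * sqrt (1 - d) \<le> 1"
proof -
  define s where "s = sqrt (1 - d)"
  have s: "0 \<le> s" "s * s = 1 - d" using d by (simp_all add: s_def)
  \<comment> \<open>The threshold forces \<open>d \<le> 16 / 25\<close> and hence
    \<open>s \<ge> 3 / 5\<close>, so that \<open>n * s\<close> absorbs the lower order
    terms.\<close>
  have d16: "d \<le> 16 / 25"
  proof (rule ccontr)
    assume "\<not> ?thesis"
    then have "16 / 25 * (n * (n - 1)) \<le> d * (n * (n - 1))" using n by (intro mult_right_mono) auto
    also have "\<dots> \<le> 2 * ((8 * n ^ 2 - 14 * n + 3) / 25)" using thr by simp
    finally show False using n by (simp add: power2_eq_square field_simps)
  qed
  have s35: "3 / 5 \<le> s" unfolding s_def by (rule real_le_rsqrt) (use d16 in \<open>simp add: power2_eq_square\<close>)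
  have dk: "d * (n - 1) \<le> 2 * k"
  proof -
    have "0 \<le> k * (k + 1)" using n by simp
    then have "d * (n * (n - 1)) \<le> 2 * k * n" using p by linarith
    then have "(d * (n - 1)) * n \<le> (2 * k) * n" by (simp add: algebra_simps)
    then show ?thesis using n by simp
  qed
  \<comment> \<open>Squares are compared: by \<open>dk\<close> the error \<open>d * n - k\<close> is
    at most \<open>d * (n + 1) / 2\<close>, which is less than \<open>n * s + 1 / 4\<close>.\<close>
  have "n - k \<le> n * s + 1 / 2"
  proof (rule ccontr)
    assume "\<not> ?thesis"
    then have "(n * s + 1 / 2) ^ 2 < (n - k) ^ 2" using n s by (intro power_strict_mono) auto
    moreover have "(n * s + 1 / 2) ^ 2 = n * n * (1 - d) + n * s + 1 / 4"
      unfolding s(2)[symmetric] by (simp add: power2_eq_square algebra_simps)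
    moreover have "(n - k) ^ 2 \<le> n * n * (1 - d) + d * n - k"
      using p by (simp add: power2_eq_square algebra_simps)
    moreover have "n * (3 / 5) \<le> n * s" using s35 n by (intro mult_left_mono) auto
    moreover have "d * (n + 1) \<le> 16 / 25 * (n + 1)" using d16 n by (intro mult_right_mono) auto
    moreover have "2 * (d * n - k) \<le> d * (n + 1)" using dk by (simp add: algebra_simps)
    ultimately show False using n(1) by argo
  qed
  then have "n * (2 - 2 * s) \<le> 2 * k + 1" by (simp add: algebra_simps)
  moreover have "s \<le> 1" using d by (simp add: s_def)
  ultimately show "(n - 1) * (2 - 2 * sqrt (1 - d)) \<le> 2 * k + 1" unfolding s_def[symmetric]
    by (simp add: algebra_simps)
  have "0 \<le> (1 - s) * (1 - s)" by simp
  then have "d \<le> 2 - 2 * s" using s(2) by (simp add: algebra_simps)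
  then show "d \<le> 2 - 2 * sqrt (1 - d)" by (simp add: s_def)
  show "2 - 2 * sqrt (1 - d) \<le> 1" using s35 by (simp add: s_def)
qed

text \<open>Here \<open>y\<close> is the fraction of edges of \<open>G\<close> in the matching and
  \<open>\<eta>\<close> the excess of its plus-density over \<open>d\<close>. Edges in the matching
  gain \<open>\<eta>\<close>, the others lose \<open>\<eta> / (n - 2)\<close>. For
  \<open>\<eta> \<ge> 0\<close> the gain uses \<open>y \<ge> 1 / D\<close>; for
  \<open>\<eta> < 0\<close> the bounds on \<open>f\<close> give \<open>\<eta> \<ge> - 2 / n\<close>,
  which the error term covers.\<close>

lemma average_bound_even_normalized:
  fixes n D d f y \<eta> :: real
  assumes n: "n \<ge> 4" and D: "D \<ge> 3" and d: "0 \<le> d" and y: "1 / D \<le> y" "y \<le> 1"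
    and eta: "d + \<eta> \<le> 1" and f: "f - d \<le> \<eta> + 2 / n" "d \<le> f"
  shows "(f - d) / D - 3 / (n - 3) \<le> y * \<eta> - (1 - y) * \<eta> / (n - 2)"
proof -
  define w where "w = 1 / (n - 3)"
  have w: "2 / n \<le> 2 * w" "1 / (n - 2) \<le> w" "3 / (n - 3) = 3 * w" "0 \<le> w"
    using n by (auto simp: w_def field_simps)
  have y0: "0 \<le> y" using y(1) D by (smt (verit) divide_nonneg_nonneg)
  have "(f - d) / D \<le> (\<eta> + 2 * w) / D" using f w D by (intro divide_right_mono) auto
  show ?thesis
  proof (cases "0 \<le> \<eta>")
    case True
    have "(1 / D) * \<eta> \<le> y * \<eta>" using y True by (intro mult_right_mono) auto
    moreover have "(1 - y) * \<eta> * (1 / (n - 2)) \<le> 1 * w"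
      using y y0 True eta d w n by (intro mult_mono mult_le_one) auto
    moreover have "2 * w / D \<le> 2 * w / 2" using D w by (intro divide_left_mono) auto
    ultimately show ?thesis using \<open>(f - d) / D \<le> _\<close> w by (simp add: add_divide_distrib)
  next
    case False
    have "(f - d) / D \<le> (f - d) / 3" using f D by (intro divide_left_mono) auto
    moreover have "\<eta> \<le> y * \<eta>" using y(2) False by (simp add: mult_le_cancel_right2)
    moreover have "(1 - y) * \<eta> / (n - 2) \<le> 0"
      using y n False by (intro divide_nonpos_nonneg mult_nonneg_nonpos) auto
    moreover have "(f - d) / 3 - 3 * w \<le> \<eta>" using f w by argo
    ultimately show ?thesis unfolding w(3) by linarith
  qed
qed

text \<open>Removing a vertex on either side costs twice: the fraction \<open>x\<close> of edges at
  the vertex of \<open>G\<close> loses \<open>d\<close> each, and plus-edges at the other vertex are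
  lost to the fraction \<open>z\<close> of edges outside of the matching.\<close>

lemma average_bound_odd_normalized:
  fixes n D d f x y z \<eta> :: real
  assumes n: "n \<ge> 4" and D: "D \<ge> 3" and d: "0 \<le> d" "d \<le> 1" and x: "0 \<le> x" "x \<le> 2 / n"
    and y: "(1 - x) / D \<le> y" and z: "z = 1 - x - y" "0 \<le> z"
    and eta: "d + \<eta> \<le> 1" and f: "f - d \<le> \<eta> + 1 / (n - 1)" "d \<le> f"
  shows "(f - d) / D - 3 / (n - 3) \<le> y * \<eta> - x * d - z * (2 * (1 - d) + \<eta>) / (n - 3)"
proof -
  define w where "w = 1 / (n - 3)"
  have w: "2 / n \<le> 2 * w" "1 / (n - 1) \<le> w" "3 / (n - 3) = 3 * w" "0 \<le> w"
    using n by (auto simp: w_def field_simps)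
  have x1: "x \<le> 1" using x n by (smt (verit) divide_le_eq_1_pos)
  have y0: "0 \<le> y" using y D x1 by (smt (verit) divide_nonneg_nonneg)
  have xd: "x * d \<le> 2 * w * d" using x w d by (intro mult_right_mono) auto
  have zw: "z * (2 * (1 - d) + \<eta>) / (n - 3) = z * (2 * (1 - d) + \<eta>) * w" by (simp add: w_def)
  show ?thesis
  proof (cases "0 \<le> \<eta>")
    case True
    have xy: "1 / D \<le> x + y"
    proof -
      have "x * (1 / D) \<le> x * 1" using x D by (intro mult_left_mono) auto
      then show ?thesis using y by (simp add: diff_divide_distrib)
    qed
    define u where "u = 1 / D"
    have u: "0 \<le> u" "3 * u \<le> 1" using D by (auto simp: u_def field_simps)
    have "(1 - x) * u * \<eta> \<le> y * \<eta>" using y True by (intro mult_right_mono) (auto simp: u_def)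
    moreover have "z * (2 * (1 - d) + \<eta>) * w \<le> (1 - u) * (3 * (1 - d)) * w"
      using z xy True eta d w u by (intro mult_right_mono mult_mono) (auto simp: u_def)
    moreover have "(x * u) * \<eta> \<le> (2 * w * u) * (1 - d)"
      using x w u True eta by (intro mult_mono) auto
    moreover have "(f - d) * u \<le> (\<eta> + w) * u" using f w u by (intro mult_right_mono) auto
    moreover have "3 * u * (d * w) \<le> 1 * (d * w)" using u d w by (intro mult_right_mono) auto
    moreover have "0 \<le> u * (d * w)" using u d w by simp
    ultimately have "(f - d) * u - 3 * w \<le> y * \<eta> - x * d - z * (2 * (1 - d) + \<eta>) * w"
      using xd by (simp add: algebra_simps)
    then show ?thesis unfolding zw w(3) by (simp add: u_def)
  next
    case False
    have "(f - d) / D \<le> (f - d) / 3" using f D by (intro divide_left_mono) auto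
    moreover have "\<eta> \<le> y * \<eta>" using z x False by (simp add: mult_le_cancel_right2)
    moreover have "z * (2 * (1 - d) + \<eta>) * w \<le> 1 * (2 * (1 - d)) * w"
    proof -
      have "z * (2 * (1 - d) + \<eta>) \<le> z * (2 * (1 - d))" using z False by (intro mult_left_mono) auto
      also have "\<dots> \<le> 1 * (2 * (1 - d))" using z x y0 d by (intro mult_right_mono) auto
      finally show ?thesis using w by (intro mult_right_mono) auto
    qed
    moreover have "(f - d) / 3 \<le> \<eta> + w" using f w by argo
    moreover have "1 * (2 * (1 - d)) * w + x * d \<le> 2 * w" using xd by (simp add: algebra_simps)
    ultimately show ?thesis unfolding zw w(3) by linarith
  qed
qed

lemma average_bound_even:
  fixes n D d f m r k t p :: real
  assumes n: "n \<ge> 4" "n = 2 * t" and D: "D \<ge> 3" and d: "0 \<le> d"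
    and p: "2 * p = d * (n * (n - 1))" and r: "m \<le> D * r" "r \<le> m" "0 \<le> m"
    and k: "k \<le> t" and f: "n * f \<le> 2 * k + 2" "d \<le> f"
  shows "(d + (f - d) / D - 3 / (n - 3)) * m \<le> r * k / t + (m - r) * (p - k) / (2 * t * (t - 1))"
proof (cases "m = 0")
  case True
  then have "r = 0" using r D by (smt (verit) zero_le_mult_iff)
  then show ?thesis using True by simp
next
  case False
  then have m: "m > 0" using r by simp
  define \<eta> where "\<eta> = k / t - d"
  define y where "y = r / m"
  have t: "t \<ge> 2" "n = 2 * t" "n - 2 > 0" using n by auto
  have k_eq: "k = (d + \<eta>) * t" using t by (simp add: \<eta>_def)
  have r_eq: "r = y * m" using m by (simp add: y_def)
  \<comment> \<open>All pairs together have plus-density \<open>d\<close>, the matching has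
    \<open>d + \<eta>\<close>, and the other \<open>2 * t * (t - 1)\<close> pairs make up for the
    difference.\<close>
  have pk: "(p - k) / (2 * t * (t - 1)) = d - \<eta> / (n - 2)"
  proof -
    have "p = d * t * (2 * t - 1)" using p t by simp
    then have "p - k = t * (2 * (t - 1) * d - \<eta>)" unfolding k_eq by (simp add: algebra_simps)
    then have "(p - k) / (2 * t * (t - 1)) = t * (2 * (t - 1) * d - \<eta>) / (2 * t * (t - 1))"
      by simp
    also have "\<dots> = d - \<eta> / (2 * (t - 1))" using t by (simp add: field_simps)
    also have "2 * (t - 1) = n - 2" using t by simp
    finally show ?thesis .
  qed
  have "(f - d) / D - 3 / (n - 3) \<le> y * \<eta> - (1 - y) * \<eta> / (n - 2)"
  proof (rule average_bound_even_normalized[OF n(1) D d])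
    show "1 / D \<le> y" using r m D by (simp add: y_def field_simps)
    show "y \<le> 1" using r m by (simp add: y_def)
    show "d + \<eta> \<le> 1" using k t by (simp add: \<eta>_def)
    show "f - d \<le> \<eta> + 2 / n" using f t by (simp add: \<eta>_def field_simps)
  qed fact
  then have "(d + (f - d) / D - 3 / (n - 3)) * m
      \<le> (d + (y * \<eta> - (1 - y) * (\<eta> / (n - 2)))) * m"
    using m by (intro mult_right_mono) auto
  also have "\<dots> = (y * m) * (d + \<eta>) + (m - y * m) * (d - \<eta> / (n - 2))"
    by (simp add: algebra_simps)
  also have "\<dots> = r * k / t + (m - r) * (p - k) / (2 * t * (t - 1))"
    using pk t unfolding r_eq k_eq by (simp flip: times_divide_eq_right)
  finally show ?thesis .
qed

lemma average_bound_odd: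
  fixes n D d f m m' r k t p p' \<delta> :: real
  assumes n: "n \<ge> 4" "n = 2 * t + 1" and D: "D \<ge> 3" and d: "0 \<le> d" "d \<le> 1"
    and p: "2 * p = d * (n * (n - 1))" "p - (n - 1) \<le> p'"
    and \<delta>: "m' = m - \<delta>" "n * \<delta> \<le> 2 * m" "0 \<le> \<delta>"
    and r: "m' \<le> D * r" "r \<le> m'" "0 \<le> m'"
    and k: "k \<le> t" and f: "(n - 1) * f \<le> 2 * k + 1" "d \<le> f"
  shows "(d + (f - d) / D - 3 / (n - 3)) * m \<le> r * k / t + (m' - r) * (p' - k) / (2 * t * (t - 1))"
proof (cases "m = 0")
  case True
  then have "m' = 0" using \<delta> r by simp
  then have "r = 0" using r D by (smt (verit) zero_le_mult_iff)
  then show ?thesis using True \<open>m' = 0\<close> by simp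
next
  case False
  then have m: "m > 0" using \<delta> r by simp
  define \<eta> where "\<eta> = k / t - d"
  define x where "x = \<delta> / m"
  define y where "y = r / m"
  define z where "z = 1 - x - y"
  have t: "t > 1" "n = 2 * t + 1" "n - 3 > 0" using n by auto
  have k_eq: "k = (d + \<eta>) * t" using t by (simp add: \<eta>_def)
  have r_eq: "r = y * m" using m by (simp add: y_def)
  have z_eq: "m' - r = z * m" using m \<delta>(1) by (simp add: z_def x_def y_def left_diff_distrib)
  \<comment> \<open>The loss of up to \<open>n - 1 = 2 * t\<close> plus-edges, set against the
    smaller number of pairs, produces the term \<open>2 * (1 - d)\<close>.\<close>
  have pk: "d - (2 * (1 - d) + \<eta>) / (n - 3) \<le> (p' - k) / (2 * t * (t - 1))"
  proof -
    have "p = d * t * (2 * t + 1)" using p t by simp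
    then have "t * (2 * (t - 1) * d - (2 * (1 - d) + \<eta>)) \<le> p' - k"
      using p(2) t unfolding k_eq by (simp add: algebra_simps)
    then have "t * (2 * (t - 1) * d - (2 * (1 - d) + \<eta>)) / (2 * t * (t - 1)) \<le> (p' - k) / (2 * t * (t - 1))"
      using t by (intro divide_right_mono) auto
    moreover have "n - 3 = 2 * (t - 1)" using t by simp
    then have "t * (2 * (t - 1) * d - (2 * (1 - d) + \<eta>)) / (2 * t * (t - 1)) = d - (2 * (1 - d) + \<eta>) / (n - 3)"
      using t by (simp add: field_simps)
    ultimately show ?thesis by simp
  qed
  have z0: "0 \<le> z" using z_eq r m by (metis diff_ge_0_iff_ge zero_le_mult_iff not_less)
  have "(f - d) / D - 3 / (n - 3) \<le> y * \<eta> - x * d - z * (2 * (1 - d) + \<eta>) / (n - 3)"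
  proof (rule average_bound_odd_normalized[OF n(1) D d _ _ _ z_def z0])
    show "0 \<le> x" using \<delta> m by (simp add: x_def)
    show "x \<le> 2 / n" using \<delta> m n by (simp add: x_def field_simps)
    have "1 - x = m' / m" using \<delta> m by (simp add: x_def field_simps)
    then show "(1 - x) / D \<le> y" using r m D by (simp add: y_def field_simps)
    show "d + \<eta> \<le> 1" using k t by (simp add: \<eta>_def)
    show "f - d \<le> \<eta> + 1 / (n - 1)" using f t by (simp add: \<eta>_def field_simps)
  qed fact
  then have "(d + (f - d) / D - 3 / (n - 3)) * m
      \<le> (d + (y * \<eta> - x * d - z * ((2 * (1 - d) + \<eta>) / (n - 3)))) * m"
    using m by (intro mult_right_mono) auto
  also have "\<dots> = (y * m) * (d + \<eta>) + (z * m) * (d - (2 * (1 - d) + \<eta>) / (n - 3))"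
    unfolding z_def by (simp add: algebra_simps)
  also have "\<dots> \<le> (y * m) * (d + \<eta>) + (z * m) * ((p' - k) / (2 * t * (t - 1)))"
    using pk z0 m by (intro add_left_mono mult_left_mono) auto
  also have "\<dots> = r * k / t + (m' - r) * (p' - k) / (2 * t * (t - 1))"
    unfolding z_eq using t unfolding r_eq k_eq by simp
  finally show ?thesis .
qed

subsection \<open>Embeddings with many plus-edges\<close>

text \<open>The average is taken for perfect matchings that extend maximum matchings of
  \<open>H\<close> and \<open>F\<close>. \<open>S\<close> and \<open>T\<close> may differ, since for
  odd order the vertices removed on the two sides are chosen independently.\<close>

lemma matching_embedding:
  fixes V S T :: "'a set"
  assumes V: "finite V" "S \<subseteq> V" "T \<subseteq> V" and t: "card S = 2 * t" "card T = 2 * t" "t \<ge> 2"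
    and H: "\<And>e. e \<in> H \<Longrightarrow> e \<subseteq> S \<and> card e = 2"
    and F: "\<And>e. e \<in> F \<Longrightarrow> e \<subseteq> T \<and> card e = 2"
  shows "\<exists>\<pi>. \<pi> permutes V \<and> real (card {e\<in>H. \<pi> ` e \<in> F}) \<ge>
    real (matching_number H) * real (matching_number F) / real t
    + (real (card H) - real (matching_number H)) * (real (card F) - real (matching_number F))
      / (2 * real t * (real t - 1))"
proof -
  have max_perfect: "finite E \<and> (\<exists>P. matching P \<and> \<Union>P = W \<and> card P = t \<and> card (E \<inter> P) = matching_number E)"
    if W: "W \<subseteq> V" "card W = 2 * t" and E: "\<And>e. e \<in> E \<Longrightarrow> e \<subseteq> W \<and> card e = 2"
    for W :: "'a set" and E
  proof -
    have finW: "finite W" using V W finite_subset by blast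
    have finE: "finite E" by (rule finite_subset[of E "Pow W"]) (use E finW in auto)
    obtain M where M: "M \<subseteq> E" "matching M" "card M = matching_number E"
      using maximum_matching[OF finE] .
    obtain P where P: "M \<subseteq> P" "matching P" "\<Union>P = W"
      using perfect_matching_extension[OF finW _ M(2), of thesis] M(1) E W(2) by auto
    have "card P = t" using matching_Un_card[OF P(2)] finW P(3) W by simp
    \<comment> \<open>\<open>E \<inter> P\<close> is itself a matching, so the extension adds no
      further edges of \<open>E\<close>.\<close>
    moreover have "card (E \<inter> P) \<le> matching_number E"
      using matching_subset[OF P(2)] finE by (intro card_matching_le) auto
    moreover have "card M \<le> card (E \<inter> P)" using M P finE by (intro card_mono) auto
    ultimately show ?thesis using P M finE by (intro conjI exI[of _ P]) auto
  qed
  obtain P where P: "matching P" "\<Union>P = S" "card P = t" "card (H \<inter> P) = matching_number H" "finite H"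
    using max_perfect[OF V(2) t(1) H] by blast
  obtain Q where Q: "matching Q" "\<Union>Q = T" "card Q = t" "card (F \<inter> Q) = matching_number F" "finite F"
    using max_perfect[OF V(3) t(2) F] by blast
  have "real (card (H - P)) = real (card H) - real (card (H \<inter> P))"
    "real (card (F - Q)) = real (card F) - real (card (F \<inter> Q))"
    using card_Int_Diff[OF P(5), of P] card_Int_Diff[OF Q(5), of Q] by linarith+
  then show ?thesis
    using matching_average[OF V(1) P(1) _ Q(1) _ P(3) Q(3) t(3), of H F] P Q V H F by simp
qed

text \<open>By maximality the vertices of a maximum matching cover all edges, and each lies in at
  most \<open>\<Delta>\<close> of them.\<close>

lemma card_le_degree_matching_number:
  assumes E: "finite E" "\<And>e. e \<in> E \<Longrightarrow> card e = 2" and deg: "\<And>v. card {e\<in>E. v \<in> e} \<le> \<Delta>"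
  shows "card E \<le> 2 * \<Delta> * matching_number E"
proof -
  obtain M where M: "M \<subseteq> E" "matching M" "card M = matching_number E"
    using maximum_matching[OF E(1)] .
  have finM: "finite M" using M E finite_subset by blast
  have "\<And>e. e \<in> M \<Longrightarrow> finite e" using M E by (auto simp: card_ge_0_finite)
  then have finU: "finite (\<Union>M)" using finM by blast
  have "E \<subseteq> (\<Union>v\<in>\<Union>M. {e\<in>E. v \<in> e})"
    using maximum_matching_meets[OF E(1) M] E(2) by fastforce
  then have "card E \<le> card (\<Union>v\<in>\<Union>M. {e\<in>E. v \<in> e})"
    using E finU by (intro card_mono finite_UN_I) simp_all
  also have "\<dots> \<le> (\<Sum>v\<in>\<Union>M. card {e\<in>E. v \<in> e})" by (rule card_UN_le[OF finU])
  also have "\<dots> \<le> (\<Sum>v\<in>\<Union>M. \<Delta>)" by (rule sum_mono) (rule deg)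
  also have "\<dots> = 2 * \<Delta> * matching_number E" using matching_card_Union[OF M(2) finM] M by simp
  finally show ?thesis .
qed

lemma handshake:
  assumes "finite V" "finite E" "\<And>e. e \<in> E \<Longrightarrow> e \<subseteq> V \<and> card e = 2"
  shows "(\<Sum>v\<in>V. card {e\<in>E. v \<in> e}) = 2 * card E"
proof -
  have "(\<Sum>v\<in>V. card {e\<in>E. v \<in> e}) = (\<Sum>e\<in>E. card {v\<in>V. v \<in> e})"
    using sum_multicount_gen[OF assms(1,2), of "\<lambda>v e. v \<in> e" "\<lambda>e. card {v\<in>V. v \<in> e}"] by simp
  also have "\<dots> = (\<Sum>e\<in>E. 2)"
  proof (rule sum.cong)
    fix e assume e: "e \<in> E"
    then have "{v\<in>V. v \<in> e} = e" using assms by auto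
    then show "card {v\<in>V. v \<in> e} = 2" using assms e by simp
  qed simp
  finally show ?thesis by simp
qed

lemma card_incident_edges_le:
  assumes "finite V" "\<And>e. e \<in> E \<Longrightarrow> e \<subseteq> V \<and> card e = 2" "w \<in> V"
  shows "card {e\<in>E. w \<in> e} \<le> card V - 1"
proof -
  have "{e\<in>E. w \<in> e} \<subseteq> (\<lambda>u. {w, u}) ` (V - {w})"
  proof
    fix e assume "e \<in> {e\<in>E. w \<in> e}"
    then have e: "e \<in> E" "w \<in> e" by auto
    then have "e \<subseteq> V" "card e = 2" using assms(2) by auto
    then obtain u where "e = {w, u}" "u \<noteq> w" using e(2) by (auto simp: card_2_iff)
    then show "e \<in> (\<lambda>u. {w, u}) ` (V - {w})" using \<open>e \<subseteq> V\<close> by auto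
  qed
  then have "card {e\<in>E. w \<in> e} \<le> card (V - {w})"
    using assms(1) by (meson finite_Diff surj_card_le)
  then show ?thesis using assms by simp
qed

text \<open>Both cases of the theorem are instances: \<open>f\<close> stands for the lower bound on
  the density of a maximum matching of plus-edges, with a rounding that suits even and odd
  orders.\<close>

lemma embedding_bound:
  fixes V :: "'a set" and E F :: "'a set set" and d f :: real and \<Delta> :: nat
  assumes V: "finite V" "card V \<ge> 4"
    and E: "\<And>e. e \<in> E \<Longrightarrow> e \<subseteq> V \<and> card e = 2"
    and F: "\<And>e. e \<in> F \<Longrightarrow> e \<subseteq> V \<and> card e = 2"
    and \<Delta>: "\<Delta> > 0" "\<And>v. card {e\<in>E. v \<in> e} \<le> \<Delta>"
    and d: "0 \<le> d" "d \<le> 1" "2 * real (card F) = d * (real (card V) * (real (card V) - 1))"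
    and f: "d \<le> f" "f \<le> 1" "(real (card V) - 1) * f \<le> 2 * real (matching_number F) + 1"
  shows "\<exists>\<pi>. \<pi> permutes V \<and> real (card {e\<in>E. \<pi> ` e \<in> F}) \<ge>
    (d + (f - d) / (2 * real \<Delta> + 1) - 3 / (real (card V) - 3)) * real (card E)"
proof -
  define D where "D = 2 * real \<Delta> + 1"
  have D: "D \<ge> 3" using \<Delta>(1) by (simp add: D_def)
  have finE: "finite E" by (rule finite_subset[of E "Pow V"]) (use E V in auto)
  have finF: "finite F" by (rule finite_subset[of F "Pow V"]) (use F V in auto)
  define k where "k = matching_number F"
  obtain M where M: "M \<subseteq> F" "matching M" "card M = k"
    using maximum_matching[OF finF] k_def by metis
  have MV: "\<Union>M \<subseteq> V" using M F by blast
  have cM: "card (\<Union>M) = 2 * k" using matching_Un_card[OF M(2)] MV V finite_subset M(3) by metis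
  have k2: "2 * k \<le> card V" using card_mono[OF V(1) MV] cM by simp
  have n4: "real (card V) \<ge> 4" using V by simp
  \<comment> \<open>Stated for subfamilies because for odd order it is applied to the edges that
    avoid \<open>w\<close>.\<close>
  have fD: "real (card H) \<le> D * real (matching_number H)" "matching_number H \<le> card H"
    if "H \<subseteq> E" for H
  proof -
    have finH: "finite H" using that finE finite_subset by blast
    have "card {e\<in>H. v \<in> e} \<le> \<Delta>" for v
      using \<Delta>(2)[of v] card_mono[of "{e\<in>E. v \<in> e}" "{e\<in>H. v \<in> e}"] finE that by fastforce
    then have "card H \<le> 2 * \<Delta> * matching_number H"
      using finH E that by (intro card_le_degree_matching_number) auto
    then have "real (card H) \<le> 2 * real \<Delta> * real (matching_number H)"
      by (metis of_nat_le_iff of_nat_mult of_nat_numeral)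
    then show "real (card H) \<le> D * real (matching_number H)" by (simp add: D_def algebra_simps)
    obtain N where "N \<subseteq> H" "matching N" "card N = matching_number H"
      using maximum_matching[OF finH] .
    then show "matching_number H \<le> card H" using card_mono[OF finH] by metis
  qed
  show ?thesis
  proof (cases "even (card V)")
    case True
    then obtain t where t: "card V = 2 * t" by blast
    obtain \<pi> where \<pi>: "\<pi> permutes V" "real (matching_number E) * real k / real t
      + (real (card E) - real (matching_number E)) * (real (card F) - real k)
        / (2 * real t * (real t - 1)) \<le> real (card {e\<in>E. \<pi> ` e \<in> F})"
      using matching_embedding[of V V V t E F] V E F t k_def by auto
    have "(d + (f - d) / D - 3 / (real (card V) - 3)) * real (card E) \<le>
      real (matching_number E) * real k / real t
      + (real (card E) - real (matching_number E)) * (real (card F) - real k)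
        / (2 * real t * (real t - 1))"
    proof (rule average_bound_even[OF n4 _ D d(1) d(3)])
      \<comment> \<open>Adding \<open>f \<le> 1\<close> passes from \<open>card V - 1\<close> to
        \<open>card V\<close>.\<close>
      show "real (card V) * f \<le> 2 * real k + 2" using f by (simp add: k_def algebra_simps)
    qed (use t k2 fD[of E] f in auto)
    then show ?thesis using \<pi> D_def by (meson order_trans)
  next
    case False
    then obtain t where t: "card V = 2 * t + 1" by (metis oddE)
    then have kt: "k \<le> t" "t \<ge> 2" using k2 V by auto
    have "V \<noteq> {}" using V by auto
    \<comment> \<open>Minimum degree keeps the loss small: by the handshake lemma \<open>w\<close>
      lies on at most \<open>2 * card E / card V\<close> edges.\<close>
    obtain w where w: "w \<in> V" "\<And>v. v \<in> V \<Longrightarrow> card {e\<in>E. w \<in> e} \<le> card {e\<in>E. v \<in> e}"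
      using arg_min_if_finite(1)[OF V(1) \<open>V \<noteq> {}\<close>] arg_min_least[OF V(1) \<open>V \<noteq> {}\<close>]
      by (rule that)
    \<comment> \<open>\<open>M\<close> covers an even number of vertices, so it misses some
      \<open>w'\<close>, and deleting \<open>w'\<close> does not lower the matching number of the
      plus-edges.\<close>
    have "\<Union>M \<noteq> V" using cM t by (metis dvd_triv_left even_plus_one_iff)
    then obtain w' where w': "w' \<in> V" "w' \<notin> \<Union>M" using MV by blast
    define H where "H = {e\<in>E. w \<notin> e}"
    define F' where "F' = {e\<in>F. w' \<notin> e}"
    have split: "card X = card {e\<in>X. \<not> v \<in> e} + card {e\<in>X. v \<in> e}"
      if "finite X" for X :: "'a set set" and v
    proof -
      have "X = {e\<in>X. \<not> v \<in> e} \<union> {e\<in>X. v \<in> e}" by blast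
      then show ?thesis using that by (subst card_Un_disjoint[symmetric]) auto
    qed
    have kF': "matching_number F' = k"
    proof (rule antisym)
      show "matching_number F' \<le> k" unfolding k_def
        by (rule matching_number_mono[OF finF]) (auto simp: F'_def)
      have "M \<subseteq> F'" using M w' by (auto simp: F'_def)
      then show "k \<le> matching_number F'"
        using card_matching_le[of F' M] M finF by (auto simp: F'_def)
    qed
    have cF': "real (card F) - (real (card V) - 1) \<le> real (card F')"
    proof -
      have "card {e\<in>F. w' \<in> e} + 1 \<le> card V"
        using card_incident_edges_le[OF V(1) _ w'(1), of F] F V(2) by simp
      then have "card F + 1 \<le> card F' + card V" using split[OF finF, of w'] unfolding F'_def by linarith
      then show ?thesis by linarith
    qed
    define \<delta> where "\<delta> = card {e\<in>E. w \<in> e}"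
    have cH: "real (card H) = real (card E) - real \<delta>"
      using split[OF finE, of w] unfolding H_def \<delta>_def by linarith
    have "card V * \<delta> \<le> (\<Sum>v\<in>V. card {e\<in>E. v \<in> e})"
      using w(2) sum_bounded_below[of V \<delta> "\<lambda>v. card {e\<in>E. v \<in> e}"] unfolding \<delta>_def by simp
    then have "card V * \<delta> \<le> 2 * card E" using handshake[OF V(1) finE] E by simp
    then have \<delta>: "real (card V) * real \<delta> \<le> 2 * real (card E)"
      by (metis of_nat_le_iff of_nat_mult of_nat_numeral)
    have HF': "e \<in> H \<Longrightarrow> e \<subseteq> V - {w} \<and> card e = 2" "e \<in> F' \<Longrightarrow> e \<subseteq> V - {w'} \<and> card e = 2" for e
      using E[of e] F[of e] by (auto simp: H_def F'_def)
    have "\<exists>\<pi>. \<pi> permutes V \<and> real (card {e\<in>H. \<pi> ` e \<in> F'}) \<ge>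
        real (matching_number H) * real (matching_number F') / real t
        + (real (card H) - real (matching_number H)) * (real (card F') - real (matching_number F'))
          / (2 * real t * (real t - 1))"
      by (rule matching_embedding[of V "V - {w}" "V - {w'}"])
        (use V t kt w(1) w'(1) HF' in \<open>simp_all\<close>)
    then obtain \<pi> where \<pi>: "\<pi> permutes V" "real (matching_number H) * real k / real t
      + (real (card H) - real (matching_number H)) * (real (card F') - real k)
        / (2 * real t * (real t - 1)) \<le> real (card {e\<in>H. \<pi> ` e \<in> F'})"
      unfolding kF' by blast
    have "(d + (f - d) / D - 3 / (real (card V) - 3)) * real (card E) \<le>
      real (matching_number H) * real k / real t
      + (real (card H) - real (matching_number H)) * (real (card F') - real k)
        / (2 * real t * (real t - 1))"
      by (rule average_bound_odd[OF n4 _ D d(1,2) d(3) cF' cH \<delta>])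
        (use t kt fD[of H] f in \<open>auto simp: H_def k_def\<close>)
    moreover have "card {e\<in>H. \<pi> ` e \<in> F'} \<le> card {e\<in>E. \<pi> ` e \<in> F}"
      using finE by (intro card_mono) (auto simp: H_def F'_def)
    ultimately show ?thesis using \<pi> unfolding D_def by (intro exI[of _ \<pi>]) linarith
  qed
qed

section \<open>Labelings of the complete graph\<close>

lemma edges_complete_graph: "edges (complete_graph n) = {e. e \<subseteq> {1..n} \<and> card e = 2}"
  by (auto simp: edges_def complete_graph_def card_2_iff; blast)

theorem theorem1:
  fixes n \<Delta> :: nat and d :: real and c :: "nat set \<Rightarrow> int" and G :: graph
  assumes "n \<ge> 4"
    and "c \<in> edges (complete_graph n) \<rightarrow> {1, -1}"
    and "real (num_plus_edges c (complete_graph n)) = d * real (n choose 2)"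
    and "\<Delta> > 0"
    and "spanning_subgraph G (complete_graph n)"
    and "max_degree G \<le> \<Delta>"
  shows "\<exists>\<pi>. \<pi> permutes {1..n} \<and>
    real (num_plus_edges c (permuted_copy \<pi> G)) \<ge>
      (if d * real (n choose 2) \<le> (8 * real n ^ 2 - 14 * real n + 3) / 25
       then (d + (2 - d - 2 * sqrt (1 - d)) / (2 * real \<Delta> + 1) - 3 / (real n - 3))
              * real (num_edges G)
       else (d + (sqrt d - d) / (2 * real \<Delta> + 1) - 3 / (real n - 3))
              * real (num_edges G))"
proof -
  define V where "V = {1..n}"
  define E where "E = edges G"
  define F where "F = {e \<in> edges (complete_graph n). c e = 1}"
  have V: "finite V" "card V = n" by (simp_all add: V_def)
  have n4: "real n \<ge> 4" using assms(1) by simp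
  have F: "e \<subseteq> V \<and> card e = 2" if "e \<in> F" for e
    using that by (simp add: F_def edges_complete_graph V_def)
  have E: "e \<subseteq> V \<and> card e = 2" if "e \<in> E" for e
    using that assms(5) unfolding spanning_subgraph_def subgraph_def E_def
    by (auto simp: edges_complete_graph V_def)
  have finE: "finite E" by (rule finite_subset[of E "Pow V"]) (use E V in auto)
  have vG: "verts G = V" using assms(5) by (simp add: spanning_subgraph_def verts_def complete_graph_def V_def)
  have deg: "card {e\<in>E. v \<in> e} \<le> \<Delta>" for v
  proof (cases "v \<in> V")
    case True
    then have "degree G v \<le> max_degree G"
      unfolding max_degree_def vG using V by (intro Max_ge) auto
    then show ?thesis using assms(6) by (simp add: degree_def E_def)
  next
    case False
    then have "{e\<in>E. v \<in> e} = {}" using E by blast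
    then show ?thesis by (metis card.empty le0)
  qed
  have "n * (n - 1) = 2 * (n choose 2)" by (cases n) (simp_all add: choose_two)
  then have "real (n * (n - 1)) = real (2 * (n choose 2))" by (simp only:)
  then have ch: "real (n choose 2) = real n * (real n - 1) / 2"
    using assms(1) by (simp add: of_nat_diff)
  have cF: "real (card F) = d * real (n choose 2)" using assms(3) by (simp add: num_plus_edges_def F_def)
  then have cF': "2 * real (card F) = d * (real n * (real n - 1))" by (simp add: ch)
  have "card F \<le> card {e. e \<subseteq> V \<and> card e = 2}"
    using F V(1) by (intro card_mono) (auto intro: finite_subset[of _ "Pow V"])
  then have "card F \<le> n choose 2" using n_subsets[OF V(1), of 2] V by simp
  then have "d * real (n choose 2) \<le> 1 * real (n choose 2)" using cF by simp
  moreover have chpos: "real (n choose 2) > 0" using n4 by (simp add: ch)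
  ultimately have d1: "d \<le> 1" by (simp only: mult_le_cancel_right_pos)
  have "0 \<le> d * real (n choose 2)" unfolding cF[symmetric] by simp
  then have d0: "0 \<le> d" using chpos by (simp add: zero_le_mult_iff)
  define k where "k = real (matching_number F)"
  have "2 * matching_number F \<le> n"
  proof -
    have "finite F" by (rule finite_subset[of F "Pow V"]) (use F V in auto)
    then obtain M where M: "M \<subseteq> F" "matching M" "card M = matching_number F"
      using maximum_matching by blast
    have "\<Union>M \<subseteq> V" using M F by blast
    then show ?thesis using matching_Un_card[OF M(2)] M(3) V finite_subset card_mono by metis
  qed
  then have k: "0 \<le> k" "2 * k \<le> real n" unfolding k_def by linarith+
  have eg: "d * (real n * (real n - 1)) / 2 \<le> k * (2 * k + 1)
      \<or> 2 * (d * (real n * (real n - 1)) / 2) \<le> 2 * k * real n - k * (k + 1)"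
  proof -
    have "d * (real n * (real n - 1)) / 2 = real (card F)" using cF' by simp
    then show ?thesis using erdos_gallai[OF V(1), of F] F unfolding V(2) k_def by simp
  qed
  \<comment> \<open>Distinct edges of \<open>G\<close> have distinct images, so those mapped into
    \<open>F\<close> yield equally many plus-edges of the copy.\<close>
  have plus: "card {e\<in>E. \<pi> ` e \<in> F} \<le> num_plus_edges c (permuted_copy \<pi> G)" if "\<pi> permutes V" for \<pi>
  proof -
    have "inj_on ((`) \<pi>) {e\<in>E. \<pi> ` e \<in> F}"
      using permutes_inj[OF that] by (simp add: inj_on_def inj_image_eq_iff)
    then have "card {e\<in>E. \<pi> ` e \<in> F} = card ((`) \<pi> ` {e\<in>E. \<pi> ` e \<in> F})" by (simp add: card_image)
    also have "\<dots> \<le> num_plus_edges c (permuted_copy \<pi> G)"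
      unfolding num_plus_edges_def permuted_copy_def using finE
      by (intro card_mono) (auto simp: edges_def E_def F_def)
    finally show ?thesis .
  qed
  \<comment> \<open>It remains to choose \<open>f\<close>: \<open>2 - 2 * sqrt (1 - d)\<close> up to
    the threshold and \<open>sqrt d\<close> above it.\<close>
  have main: "\<exists>\<pi>. \<pi> permutes {1..n} \<and> real (num_plus_edges c (permuted_copy \<pi> G)) \<ge>
      (d + (f - d) / (2 * real \<Delta> + 1) - 3 / (real n - 3)) * real (num_edges G)"
    if f: "d \<le> f" "f \<le> 1" "(real n - 1) * f \<le> 2 * k + 1" for f
  proof -
    obtain \<pi> where "\<pi> permutes V" "real (card {e\<in>E. \<pi> ` e \<in> F}) \<ge>
      (d + (f - d) / (2 * real \<Delta> + 1) - 3 / (real n - 3)) * real (card E)"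
      using embedding_bound[OF V(1), of E F \<Delta> d f] E F deg d0 d1 f V(2) assms(1,4) cF'
      unfolding k_def by auto
    then show ?thesis using plus[of \<pi>] unfolding V_def num_edges_def E_def
      by (intro exI[of _ \<pi>]) linarith
  qed
  show ?thesis
  proof (cases "d * real (n choose 2) \<le> (8 * real n ^ 2 - 14 * real n + 3) / 25")
    case True
    then have thr: "d * (real n * (real n - 1)) / 2 \<le> (8 * real n ^ 2 - 14 * real n + 3) / 25"
      by (simp add: ch)
    \<comment> \<open>Up to the threshold the second alternative of \<open>eg\<close> holds
      whichever of the two is given.\<close>
    have "d * (real n * (real n - 1)) \<le> 2 * k * real n - k * (k + 1)"
      using erdos_gallai_threshold(1)[OF n4 k eg thr] by simp
    from matching_density_star[OF n4 k d0 d1 this thr]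
    have "\<exists>\<pi>. \<pi> permutes {1..n} \<and> real (num_plus_edges c (permuted_copy \<pi> G)) \<ge>
      (d + (2 - 2 * sqrt (1 - d) - d) / (2 * real \<Delta> + 1) - 3 / (real n - 3)) * real (num_edges G)"
      by (intro main)
    moreover have "2 - 2 * sqrt (1 - d) - d = 2 - d - 2 * sqrt (1 - d)" by simp
    ultimately show ?thesis using True by simp
  next
    case False
    then have thr: "\<not> d * (real n * (real n - 1)) / 2 \<le> (8 * real n ^ 2 - 14 * real n + 3) / 25"
      by (simp add: ch)
    from matching_density_clique[OF n4 k(1) d0 d1 erdos_gallai_threshold(2)[OF n4 k eg thr]]
    show ?thesis using False main[of "sqrt d"] by simp
  qed
qed

end
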